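(* Let $G=G_0$ be the ellipsoid $$G_0=\{[f_0,f_1]\in F_0\times F_1:(Q_0f_0,f_0)_{F_0}+(Q_1f_1,f_1)_{F_1}\le1\},$$ where $Q_i\in\mathscr L(F_i)$ is self-adjoint, $Q_i\ge\beta_iI$, $\beta_i>0$, $i=0,1$, and let $$G_1=\Big\{R_\eta:\int_0^TE(Q(t)\eta(t),\eta(t))_H\,dt\le\gamma_T^2\Big\},\qquad R_\eta\in G_1.$$ Then $$\inf_{U\in L^2(0,T,\mathscr L(H,H_V))}\ \sup_{[f_0,f_1]\in G_0,\,R_\eta\in G_1}E\Big\|V\varphi-\int_0^TU(t)y(t)\,dt\Big\|_{H_V}^2\ \ge\ \sup_{\ell:\|\ell\|_{H_V}=1}(\ell,Vp)_{H_V},$$ provided $p=p(\ell)\in H_+(N)$ (together with $z\in H_+(N^+)$) solves $$N^+z=V^\star\Lambda\ell-\gamma_T^{-2}B_Tp,\quad\delta^+z=0,$$ $$Np=B_1Q_1^{-1}\Lambda_1^{-1}B_1^\star z,\quad\delta p=B_0Q_0^{-1}\Lambda_0^{-1}B_0^\star\gamma z,$$ where $B_T=\int_0^TC^\star(t)\Lambda_HQ(t)C(t)\,dt$ and $\Lambda_i:F_i\to F_i^\star$ is the canonical isomorphism of $F_i$ onto its adjoint space.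
   Context: All Hilbert spaces are real; $\mathscr L(X,Y)$ denotes bounded linear operators; $\langle\cdot,\cdot\rangle$ is the duality pairing between a Hilbert space and its dual; for $A\in\mathscr L(X,Y)$, $A^\star\in\mathscr L(Y^\star,X^\star)$ is its adjoint (so $B_1^\star\in\mathscr L(H_0,F_1^\star)$ and $B_0^\star\in\mathscr L(H_\partial,F_0^\star)$). Abstract Neumann problem. $H_+\subseteq H_0\subseteq H_-$ are Hilbert spaces (continuous embeddings) with inner products $(\cdot,\cdot)_+,(\cdot,\cdot)_0,(\cdot,\cdot)_-$; $H_0$ is identified with $H_0^\star$. $a$ is a continuous bilinear form on $H_+\times H_+$ with $a(\phi,\phi)\ge\alpha^2(\phi,\phi)_+$ for all $\phi\in H_+$ and some $\alpha\neq0$. $H_\partial$ is a Hilbert space, $\gamma\in\mathscr L(H_+,H_\partial)$ is surjective, and $\mathring H_+:=\ker\gamma$ is dense in $H_0$; $\mathring H_-:=\mathring H_+^\star$, so $\mathring H_+\subseteq H_0\subseteq\mathring H_-$. For $\phi\in H_+$ put $N\phi:=a(\phi,\cdot)\in\mathring H_-$ and $N^+\phi:=a(\cdot,\phi)\in\mathring H_-$ (functionals on $\mathring H_+$); $H_+(N):=\{\phi\in H_+:N\phi\in H_0\}$, $H_+(N^+):=\{\phi\in H_+:N^+\phi\in H_0\}$, with graph norms. $\delta\in\mathscr L(H_+(N),H_\partial^\star)$ and $\delta^+\in\mathscr L(H_+(N^+),H_\partial^\star)$ are the operators determined by the Green formulas $a(\phi,\psi)=(N\phi,\psi)_0+\langle\delta\phi,\gamma\psi\rangle$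 for $\phi\in H_+(N),\psi\in H_+$, and $a(\psi,\phi)=(N^+\phi,\psi)_0+\langle\delta^+\phi,\gamma\psi\rangle$ for $\phi\in H_+(N^+),\psi\in H_+$. State and observations. $F_0,F_1,H,H_V$ are Hilbert spaces, $B_0\in\mathscr L(F_0,H_\partial^\star)$, $B_1\in\mathscr L(F_1,H_0)$, $V\in\mathscr L(H_0,H_V)$, $T>0$. The state $\varphi\in H_+(N)$ is the unique solution of $N\varphi=B_1f_1$, $\delta\varphi=B_0f_0$, with uncertain $[f_0,f_1]\in G\subset F_0\times F_1$. One observes $y(t)=C(t)\varphi+\eta(t)$, $t\in[0,T]$, where $C(t)\in\mathscr L(H_0,H)$ is given (all integrals being assumed well defined) and $\eta$ is an $H$-valued random process with $E\eta(t)=0$, $\int_0^TE\|\eta(t)\|_H^2dt<\infty$, whose correlation operator $R_\eta$, $(R_\eta(t,s)x_1,x_2)_H=E(\eta(t),x_1)_H(\eta(s),x_2)_H$, is unknown and belongs to a given set $G_1$. $\Lambda:H_V\to H_V^\star$ and $\Lambda_H:H\to H^\star$ are the canonical (Riesz) isomorphisms. $Q(t)\in\mathscr L(H)$ satisfies $Q(t)=Q^\star(t)\ge\alpha^2I$ (self-adjoint, with some $\alpha\neq0$ independent of $t$), $t\mapsto\|Q(t)\|$ is continuous, and $\gamma_T$ is a given positive number. *)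

theory Defs
  imports "HOL-Probability.Probability"
begin

section \<open>Duals and adjoints\<close>

abbreviation riesz :: "'a::real_inner \<Rightarrow> ('a \<Rightarrow>\<^sub>L real)" where
  "riesz \<equiv> blinfun_inner_right"

lift_definition adjoint_op ::
    "('a::real_normed_vector \<Rightarrow>\<^sub>L 'b::real_normed_vector) \<Rightarrow> ('b \<Rightarrow>\<^sub>L real) \<Rightarrow>\<^sub>L ('a \<Rightarrow>\<^sub>L real)"
  is "\<lambda>A g. g o\<^sub>L A"
  by (rule bounded_bilinear.bounded_linear_left[OF bounded_bilinear_blinfun_compose])

text \<open>
  \<open>bidual\<close> is the evaluation map identifying a Hilbert space with its second dual; it is what
  makes $B_0^\star$, for $B_0\in\mathscr L(F_0,H_\partial^\star)$, act on $H_\partial$.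
\<close>

lift_definition bidual :: "'a::real_normed_vector \<Rightarrow> ('a \<Rightarrow>\<^sub>L real) \<Rightarrow>\<^sub>L real"
  is "\<lambda>x g. blinfun_apply g x"
  by (rule bounded_bilinear.bounded_linear_left[OF bounded_bilinear_blinfun_apply])

definition self_adjoint_coercive :: "real \<Rightarrow> ('a::real_inner \<Rightarrow>\<^sub>L 'a) \<Rightarrow> bool" where
  "self_adjoint_coercive c A \<longleftrightarrow>
     (\<forall>x y. blinfun_apply A x \<bullet> y = x \<bullet> blinfun_apply A y) \<and> (\<forall>x. blinfun_apply A x \<bullet> x \<ge> c * (x \<bullet> x))"

section \<open>Bochner integration without separability\<close>

text \<open>
  The library's Bochner integral is restricted to second countable spaces, which excludes
  operator-valued functions and non-separable Hilbert spaces. The definitions below have the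
  same clauses as \<^const>\<open>has_bochner_integral\<close>, at the sort of all normed spaces
  (the library's own notion of simple integral is hidden after its development).
\<close>

definition strongly_measurable :: "'a measure \<Rightarrow> ('a \<Rightarrow> 'b::real_normed_vector) \<Rightarrow> bool" where
  "strongly_measurable M f \<longleftrightarrow> f \<in> borel_measurable M \<and>
     (\<exists>s. (\<forall>i::nat. simple_function M (s i)) \<and> (AE x in M. (\<lambda>i. s i x) \<longlonglongrightarrow> f x))"

definition simple_integrable :: "'a measure \<Rightarrow> ('a \<Rightarrow> 'b::real_normed_vector) \<Rightarrow> bool" where
  "simple_integrable M s \<longleftrightarrow> simple_function M s \<and> emeasure M {x\<in>space M. s x \<noteq> 0} \<noteq> \<infinity>"

definition simple_vector_integral :: "'a measure \<Rightarrow> ('a \<Rightarrow> 'b::real_normed_vector) \<Rightarrow> 'b" where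
  "simple_vector_integral M s = (\<Sum>y\<in>s ` space M. measure M {x\<in>space M. s x = y} *\<^sub>R y)"

definition bochner_integral ::
    "'a measure \<Rightarrow> ('a \<Rightarrow> 'b::real_normed_vector) \<Rightarrow> 'b \<Rightarrow> bool" where
  "bochner_integral M f v \<longleftrightarrow> f \<in> borel_measurable M \<and>
     (\<exists>s. (\<forall>i::nat. simple_integrable M (s i)) \<and>
          (\<lambda>i. \<integral>\<^sup>+x. ennreal (norm (f x - s i x)) \<partial>M) \<longlonglongrightarrow> 0 \<and>
          (\<lambda>i. simple_vector_integral M (s i)) \<longlonglongrightarrow> v)"

definition bochner_integrable :: "'a measure \<Rightarrow> ('a \<Rightarrow> 'b::real_normed_vector) \<Rightarrow> bool" where
  "bochner_integrable M f \<longleftrightarrow> (\<exists>v. bochner_integral M f v)"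

definition bochner :: "'a measure \<Rightarrow> ('a \<Rightarrow> 'b::real_normed_vector) \<Rightarrow> 'b" where
  "bochner M f = (THE v. bochner_integral M f v)"

definition L2 :: "real \<Rightarrow> (real \<Rightarrow> 'b::real_normed_vector) set" where
  "L2 T = {U. strongly_measurable (lebesgue_on {0..T}) U \<and>
              (\<integral>\<^sup>+t. ennreal ((norm (U t))\<^sup>2) \<partial>lebesgue_on {0..T}) < \<infinity>}"

section \<open>The abstract Neumann problem\<close>

text \<open>
  Embeddings are explicit injections: \<open>j\<close> maps $H_+$ into $H_0$ and \<open>k\<close> maps $H_0$ into $H_-$.
  Functionals on the kernel of \<open>\<gamma>\<close> are represented by functions on $H_+$ restricted
  (with value \<open>undefined\<close> outside) to that kernel; \<open>pivot_embedding\<close> is the inclusion of $H_0$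
  into the dual of the kernel. \<open>N0\<close> is $N\varphi$ regarded as an element of $H_0$, and is
  meaningful on \<open>dom_N\<close> only.
  The operator $N^+$ is \<open>N_op\<close> for the transposed form.
\<close>

definition N_op ::
    "('p::real_normed_vector \<Rightarrow> 'p \<Rightarrow> real) \<Rightarrow> ('p \<Rightarrow>\<^sub>L 'b::real_normed_vector) \<Rightarrow> 'p \<Rightarrow> ('p \<Rightarrow> real)"
  where "N_op a \<gamma> \<phi> = (\<lambda>\<psi>\<in>{\<psi>. blinfun_apply \<gamma> \<psi> = 0}. a \<phi> \<psi>)"

definition pivot_embedding ::
    "('p::real_normed_vector \<Rightarrow>\<^sub>L 'h0::real_inner) \<Rightarrow> ('p \<Rightarrow>\<^sub>L 'b::real_normed_vector) \<Rightarrow>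
     'h0 \<Rightarrow> ('p \<Rightarrow> real)"
  where "pivot_embedding j \<gamma> h = (\<lambda>\<psi>\<in>{\<psi>. blinfun_apply \<gamma> \<psi> = 0}. h \<bullet> blinfun_apply j \<psi>)"

definition dom_N ::
    "('p::real_normed_vector \<Rightarrow>\<^sub>L 'h0::real_inner) \<Rightarrow> ('p \<Rightarrow> 'p \<Rightarrow> real) \<Rightarrow>
     ('p \<Rightarrow>\<^sub>L 'b::real_normed_vector) \<Rightarrow> 'p set"
  where "dom_N j a \<gamma> = {\<phi>. N_op a \<gamma> \<phi> \<in> range (pivot_embedding j \<gamma>)}"

definition N0 ::
    "('p::real_normed_vector \<Rightarrow>\<^sub>L 'h0::real_inner) \<Rightarrow> ('p \<Rightarrow> 'p \<Rightarrow> real) \<Rightarrow>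
     ('p \<Rightarrow>\<^sub>L 'b::real_normed_vector) \<Rightarrow> 'p \<Rightarrow> 'h0"
  where "N0 j a \<gamma> \<phi> = inv (pivot_embedding j \<gamma>) (N_op a \<gamma> \<phi>)"

abbreviation (input) transposed :: "('p \<Rightarrow> 'p \<Rightarrow> real) \<Rightarrow> ('p \<Rightarrow> 'p \<Rightarrow> real)" where
  "transposed a \<equiv> (\<lambda>\<phi> \<psi>. a \<psi> \<phi>)"

text \<open>
  Linearity and continuity for the graph norm, together with the Green formula, which determines
  \<open>\<delta>\<close> on \<open>dom_N\<close> because \<open>\<gamma>\<close> is onto; values of \<open>\<delta>\<close> off \<open>dom_N\<close> are arbitrary.
\<close>

definition green_operator ::
    "('p::real_normed_vector \<Rightarrow>\<^sub>L 'h0::real_inner) \<Rightarrow> ('p \<Rightarrow> 'p \<Rightarrow> real) \<Rightarrow>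
     ('p \<Rightarrow>\<^sub>L 'b::real_normed_vector) \<Rightarrow> ('p \<Rightarrow> ('b \<Rightarrow>\<^sub>L real)) \<Rightarrow> bool"
  where "green_operator j a \<gamma> \<delta> \<longleftrightarrow>
    (\<forall>\<phi>\<in>dom_N j a \<gamma>. \<forall>\<phi>'\<in>dom_N j a \<gamma>. \<delta> (\<phi> + \<phi>') = \<delta> \<phi> + \<delta> \<phi>') \<and>
    (\<forall>c. \<forall>\<phi>\<in>dom_N j a \<gamma>. \<delta> (c *\<^sub>R \<phi>) = c *\<^sub>R \<delta> \<phi>) \<and>
    (\<exists>K. \<forall>\<phi>\<in>dom_N j a \<gamma>. norm (\<delta> \<phi>) \<le> K * sqrt ((norm \<phi>)\<^sup>2 + (norm (N0 j a \<gamma> \<phi>))\<^sup>2)) \<and>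
    (\<forall>\<phi>\<in>dom_N j a \<gamma>. \<forall>\<psi>. a \<phi> \<psi> = N0 j a \<gamma> \<phi> \<bullet> blinfun_apply j \<psi> + blinfun_apply (\<delta> \<phi>) (blinfun_apply \<gamma> \<psi>))"

definition solves_neumann ::
    "('p::real_normed_vector \<Rightarrow>\<^sub>L 'h0::real_inner) \<Rightarrow> ('p \<Rightarrow> 'p \<Rightarrow> real) \<Rightarrow>
     ('p \<Rightarrow>\<^sub>L 'b::real_normed_vector) \<Rightarrow> ('p \<Rightarrow> ('b \<Rightarrow>\<^sub>L real)) \<Rightarrow>
     'h0 \<Rightarrow> ('b \<Rightarrow>\<^sub>L real) \<Rightarrow> 'p \<Rightarrow> bool"
  where "solves_neumann j a \<gamma> \<delta> g h \<phi> \<longleftrightarrow>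
    \<phi> \<in> dom_N j a \<gamma> \<and> N0 j a \<gamma> \<phi> = g \<and> \<delta> \<phi> = h"

locale neumann_problem =
  fixes j :: "'p::{real_inner,complete_space} \<Rightarrow>\<^sub>L 'h0::{real_inner,complete_space}"
    and k :: "'h0 \<Rightarrow>\<^sub>L 'm::{real_inner,complete_space}"
    and a :: "'p \<Rightarrow> 'p \<Rightarrow> real"
    and \<gamma> :: "'p \<Rightarrow>\<^sub>L 'b::{real_inner,complete_space}"
    and \<delta> \<delta>p :: "'p \<Rightarrow> ('b \<Rightarrow>\<^sub>L real)"
  assumes inj_j: "inj (blinfun_apply j)"
    and inj_k: "inj (blinfun_apply k)"
    and form_bounded: "bounded_bilinear a"
    and form_coercive: "\<exists>\<alpha>::real. \<alpha> \<noteq> 0 \<and> (\<forall>\<phi>. a \<phi> \<phi> \<ge> \<alpha>\<^sup>2 * (\<phi> \<bullet> \<phi>))"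
    and trace_onto: "surj (blinfun_apply \<gamma>)"
    and kernel_dense: "closure (blinfun_apply j ` {\<psi>. blinfun_apply \<gamma> \<psi> = 0}) = UNIV"
    and green: "green_operator j a \<gamma> \<delta>"
    and green_transposed: "green_operator j (transposed a) \<gamma> \<delta>p"

section \<open>State, noise and estimation error\<close>

definition state ::
    "('p::real_normed_vector \<Rightarrow>\<^sub>L 'h0::real_inner) \<Rightarrow> ('p \<Rightarrow> 'p \<Rightarrow> real) \<Rightarrow>
     ('p \<Rightarrow>\<^sub>L 'b::real_normed_vector) \<Rightarrow> ('p \<Rightarrow> ('b \<Rightarrow>\<^sub>L real)) \<Rightarrow>
     ('f0::real_normed_vector \<Rightarrow>\<^sub>L ('b \<Rightarrow>\<^sub>L real)) \<Rightarrow> ('f1::real_normed_vector \<Rightarrow>\<^sub>L 'h0) \<Rightarrow>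
     'f0 \<Rightarrow> 'f1 \<Rightarrow> 'p"
  where "state j a \<gamma> \<delta> B0 B1 f0 f1 =
    (THE \<phi>. solves_neumann j a \<gamma> \<delta> (blinfun_apply B1 f1) (blinfun_apply B0 f0) \<phi>)"

definition noise :: "real \<Rightarrow> 'w measure \<Rightarrow> (real \<Rightarrow> 'w \<Rightarrow> 'h::real_inner) \<Rightarrow> bool" where
  "noise T M \<eta> \<longleftrightarrow> prob_space M \<and>
     strongly_measurable (lebesgue_on {0..T} \<Otimes>\<^sub>M M) (\<lambda>(t, \<omega>). \<eta> t \<omega>) \<and>
     (\<forall>t\<in>{0..T}. bochner_integrable M (\<eta> t) \<and> bochner M (\<eta> t) = 0) \<and>
     (\<integral>\<^sup>+t. (\<integral>\<^sup>+\<omega>. ennreal ((norm (\<eta> t \<omega>))\<^sup>2) \<partial>M) \<partial>lebesgue_on {0..T}) < \<infinity>"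

definition correlation_operator ::
    "real \<Rightarrow> 'w measure \<Rightarrow> (real \<Rightarrow> 'w \<Rightarrow> 'h::real_inner) \<Rightarrow>
     (real \<Rightarrow> real \<Rightarrow> ('h \<Rightarrow>\<^sub>L 'h)) \<Rightarrow> bool" where
  "correlation_operator T M \<eta> R \<longleftrightarrow> (\<forall>t\<in>{0..T}. \<forall>s\<in>{0..T}. \<forall>x1 x2.
     integrable M (\<lambda>\<omega>. (\<eta> t \<omega> \<bullet> x1) * (\<eta> s \<omega> \<bullet> x2)) \<and>
     blinfun_apply (R t s) x1 \<bullet> x2 = (\<integral>\<omega>. (\<eta> t \<omega> \<bullet> x1) * (\<eta> s \<omega> \<bullet> x2) \<partial>M))"

definition G0 :: "('f0::real_inner \<Rightarrow>\<^sub>L 'f0) \<Rightarrow> ('f1::real_inner \<Rightarrow>\<^sub>L 'f1) \<Rightarrow> ('f0 \<times> 'f1) set" where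
  "G0 Q0 Q1 = {(f0, f1). blinfun_apply Q0 f0 \<bullet> f0 + blinfun_apply Q1 f1 \<bullet> f1 \<le> 1}"

text \<open>
  HOL cannot quantify over the sample space type inside a set, hence the type argument: processes
  live on arbitrary probability spaces over the type \<open>'w\<close>. Over a one-point type the only
  zero-mean process is 0, so statements about the supremum over \<open>G1\<close> need at least two outcomes.
\<close>

definition G1 ::
    "'w itself \<Rightarrow> real \<Rightarrow> (real \<Rightarrow> ('h::real_inner \<Rightarrow>\<^sub>L 'h)) \<Rightarrow> real \<Rightarrow>
     (real \<Rightarrow> real \<Rightarrow> ('h \<Rightarrow>\<^sub>L 'h)) set" where
  "G1 _ T Q \<gamma>T = {R. \<exists>(M :: 'w measure) \<eta>. noise T M \<eta> \<and> correlation_operator T M \<eta> R \<and>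
     (\<integral>\<^sup>+t. (\<integral>\<^sup>+\<omega>. ennreal (blinfun_apply (Q t) (\<eta> t \<omega>) \<bullet> \<eta> t \<omega>) \<partial>M) \<partial>lebesgue_on {0..T}) \<le> ennreal (\<gamma>T\<^sup>2)}"

definition mean_square_error ::
    "real \<Rightarrow> (real \<Rightarrow> ('h0::real_inner \<Rightarrow>\<^sub>L 'h::real_inner)) \<Rightarrow> ('h0 \<Rightarrow>\<^sub>L 'v::real_inner) \<Rightarrow>
     (real \<Rightarrow> ('h \<Rightarrow>\<^sub>L 'v)) \<Rightarrow> 'h0 \<Rightarrow> 'w measure \<Rightarrow> (real \<Rightarrow> 'w \<Rightarrow> 'h) \<Rightarrow> ereal" where
  "mean_square_error T C V U \<phi> M \<eta> = enn2ereal (\<integral>\<^sup>+\<omega>.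
     ennreal ((norm (blinfun_apply V \<phi> -
       bochner (lebesgue_on {0..T}) (\<lambda>t. blinfun_apply (U t) (blinfun_apply (C t) \<phi> + \<eta> t \<omega>))))\<^sup>2) \<partial>M)"

text \<open>
  The operator $C^\star(t)\Lambda_H Q(t) C(t)$ and its time integral; \<open>inv riesz\<close> is the
  identification of the dual of $H_0$ with $H_0$.
\<close>

definition observation_density ::
    "(real \<Rightarrow> ('h0::real_inner \<Rightarrow>\<^sub>L 'h::real_inner)) \<Rightarrow> (real \<Rightarrow> ('h \<Rightarrow>\<^sub>L 'h)) \<Rightarrow> 'h0 \<Rightarrow> real \<Rightarrow> 'h0"
  where "observation_density C Q x t = 
    inv riesz (blinfun_apply (adjoint_op (C t)) (riesz (blinfun_apply (Q t) (blinfun_apply (C t) x))))"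

definition B_T ::
    "real \<Rightarrow> (real \<Rightarrow> ('h0::real_inner \<Rightarrow>\<^sub>L 'h::real_inner)) \<Rightarrow> (real \<Rightarrow> ('h \<Rightarrow>\<^sub>L 'h)) \<Rightarrow> 'h0 \<Rightarrow> 'h0"
  where "B_T T C Q x = bochner (lebesgue_on {0..T}) (observation_density C Q x)"

end

theory Submission
  imports Defs
begin

text \<open>
  Fix a unit vector \<open>l\<close>, an estimator \<open>U\<close>, and put $\varphi=p(l)$, $w=\int_0^T U C\varphi\,dt$.
  The Green formulas give $(l,V\varphi)=A+D$, where $A$ is the value of the ellipsoid form at the data
  $[f_0,f_1]$ generating $\varphi$ and $D=\gamma_T^{-2}\int_0^T(QC\varphi,C\varphi)\,dt$. For scalars with
  $s^2A\le 1$ and $r^2D\le 1$ the data $s[f_0,f_1]$ and the noise $\pm rC(t)\varphi$, each sign with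
  probability $1/2$, are admissible, and the error they produce is
  $s^2\|V\varphi-w\|^2+r^2\|w\|^2$. A suitable choice of \<open>s\<close> and \<open>r\<close> makes this at least $A+D$,
  whatever \<open>w\<close> is.
\<close>

text \<open>The supremum is taken with \<open>U\<close> fixed, so the scales \<open>s\<close> and
  \<open>r\<close> may depend on \<open>w\<close>. Noise parallel to the exact observation is the
  useful choice because the estimator then only sees multiples of one signal and enters the error
  through \<open>w\<close> alone. The two constraints on the scales are the two membership
  conditions: the ellipsoid form at the scaled data is \<open>s\<^sup>2 * A\<close>, and the
  weighted noise energy is \<open>\<gamma>T\<^sup>2 * (r\<^sup>2 * D)\<close>. Most of the length
  comes from measurability. The spaces may be non-separable and \<open>U\<close> is operator-valued,
  so a difference of Borel functions, or the evaluation of one at another, need not be Borel.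
  Measurability is therefore carried by simple approximants, and vector integrals are identified
  through their inner products with fixed vectors, which are scalar integrals.\<close>

section \<open>Coercive operators on Hilbert spaces\<close>

text \<open>The representing vector minimises \<open>A x \<bullet> x - 2 * F x\<close>.\<close>

lemma self_adjoint_coercive_represents:
  fixes A :: "'a::{real_inner,complete_space} \<Rightarrow>\<^sub>L 'a" and F :: "'a \<Rightarrow>\<^sub>L real"
  assumes c: "c > 0" and A: "self_adjoint_coercive c A"
  shows "\<exists>x. \<forall>y. A x \<bullet> y = F y"
proof -
  define J where "J x = A x \<bullet> x - 2 * F x" for x
  have sym: "A x \<bullet> y = A y \<bullet> x" for x y
    using A by (simp add: self_adjoint_coercive_def inner_commute)
  have coer: "A x \<bullet> x \<ge> c * (norm x)\<^sup>2" for x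
    using A unfolding self_adjoint_coercive_def power2_norm_eq_inner by blast
  have low: "J x \<ge> - ((norm F)\<^sup>2 / c)" for x
  proof -
    have "F x \<le> norm F * norm x"
      using norm_blinfun[of F x] by simp
    moreover have "0 \<le> (c * norm x - norm F)\<^sup>2 / c" using c by simp
    then have "0 \<le> c * (norm x)\<^sup>2 - 2 * (norm F * norm x) + (norm F)\<^sup>2 / c"
      using c by (simp add: field_simps power2_eq_square)
    ultimately show ?thesis using coer[of x] by (simp add: J_def)
  qed
  define m where "m = (INF x. J x)"
  have bdd: "bdd_below (range J)" using low by (auto intro!: bdd_belowI)
  have m_le: "m \<le> J x" for x
    unfolding m_def by (rule cINF_lower[OF bdd]) simp
  have "\<exists>x. J x < m + e" if "e > 0" for e
  proof -
    have "Inf (range J) < m + e" using that by (simp add: m_def)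
    then show ?thesis using cInf_lessD[of "range J" "m + e"] by auto
  qed
  then have "\<forall>n. \<exists>x. J x < m + 1 / Suc n" by simp
  then obtain X where X: "\<And>n. J (X n) < m + 1 / Suc n" by metis
  \<comment> \<open>The parallelogram identity makes every minimising sequence Cauchy.\<close>
  have para: "J x + J y = 2 * J ((1/2) *\<^sub>R (x + y)) + (A (x - y) \<bullet> (x - y)) / 2" for x y
    using sym[of x y]
    by (simp add: J_def blinfun.bilinear_simps inner_simps field_simps)
  have dist: "(norm (x - y))\<^sup>2 \<le> 2 / c * (J x + J y - 2 * m)" for x y
  proof -
    have "c * (norm (x - y))\<^sup>2 / 2 \<le> J x + J y - 2 * m"
      using para[of x y] coer[of "x - y"] m_le[of "(1/2) *\<^sub>R (x + y)"] by linarith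
    then show ?thesis using c by (simp add: field_simps)
  qed
  have "Cauchy X"
  proof (rule metric_CauchyI)
    fix e :: real assume e: "e > 0"
    \<comment> \<open>Chosen so that \<open>2 / c * (2 * d)\<close> is exactly
      \<open>e\<^sup>2\<close>.\<close>
    define d where "d = e\<^sup>2 * c / 4"
    have d: "d > 0" using e c by (simp add: d_def)
    obtain N where N: "1 / Suc N < d" using nat_approx_posE[OF d] by auto
    have small: "J (X n) < m + d" if "n \<ge> N" for n
    proof -
      have "1 / real (Suc n) \<le> 1 / Suc N" using that by (simp add: frac_le)
      then show ?thesis using X[of n] N by linarith
    qed
    have "dist (X n) (X k) < e" if "n \<ge> N" "k \<ge> N" for n k
    proof -
      have "(norm (X n - X k))\<^sup>2 \<le> 2 / c * (J (X n) + J (X k) - 2 * m)" by (rule dist)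
      also have "\<dots> < 2 / c * (2 * d)"
        using small[OF that(1)] small[OF that(2)] c by (intro mult_strict_left_mono) auto
      also have "\<dots> = e\<^sup>2" using c by (simp add: d_def)
      finally show ?thesis using e by (simp add: dist_norm power2_less_imp_less)
    qed
    then show "\<exists>N. \<forall>n\<ge>N. \<forall>k\<ge>N. dist (X n) (X k) < e" by blast
  qed
  then obtain x where x: "X \<longlonglongrightarrow> x" using Cauchy_convergent_iff convergent_def by blast
  have "(\<lambda>n. J (X n)) \<longlonglongrightarrow> J x"
    unfolding J_def by (intro tendsto_intros x)
  moreover have "(\<lambda>n. J (X n)) \<longlonglongrightarrow> m"
  proof (rule tendsto_sandwich[of "\<lambda>_. m" _ _ "\<lambda>n. m + 1 / Suc n"])
    show "(\<lambda>n. m + 1 / real (Suc n)) \<longlonglongrightarrow> m"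
      using tendsto_add[OF tendsto_const[of m] LIMSEQ_inverse_real_of_nat]
      by (simp add: inverse_eq_divide)
  qed (use m_le less_imp_le[OF X] in \<open>auto simp del: of_nat_Suc\<close>)
  ultimately have Jx: "J x = m" by (rule LIMSEQ_unique)
  have "A x \<bullet> y = F y" for y
  proof -
    define b where "b = A x \<bullet> y - F y"
    define q where "q = A y \<bullet> y"
    have expand: "0 \<le> 2 * t * b + t\<^sup>2 * q" for t
    proof -
      have "A (x + t *\<^sub>R y) \<bullet> (x + t *\<^sub>R y) = A x \<bullet> x + 2 * t * (A x \<bullet> y) + t\<^sup>2 * (A y \<bullet> y)"
        by (simp add: blinfun.add_right blinfun.scaleR_right inner_add_left inner_add_right
            sym[of y x] power2_eq_square distrib_left)
      then have "J (x + t *\<^sub>R y) = J x + 2 * t * b + t\<^sup>2 * q"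
        by (simp add: J_def b_def q_def blinfun.add_right blinfun.scaleR_right algebra_simps)
      then show ?thesis using m_le[of "x + t *\<^sub>R y"] Jx by linarith
    qed
    have q: "q \<ge> 0" using coer[of y] c by (simp add: q_def order_trans[rotated])
    \<comment> \<open>Here \<open>b\<close> is half the derivative of \<open>J\<close> at
      \<open>x\<close> in the direction \<open>y\<close>. The minimising step \<open>- b / q\<close>
      would divide by zero for \<open>y = 0\<close>; with \<open>q + 1\<close> in the denominator
      the value is still negative unless \<open>b = 0\<close>.\<close>
    have "2 * (- b / (q + 1)) * b + (- b / (q + 1))\<^sup>2 * q = - (b\<^sup>2 * (q + 2)) / (q + 1)\<^sup>2"
      using q by (simp add: divide_simps power2_eq_square) (simp add: algebra_simps)
    with expand[of "- b / (q + 1)"] have "b\<^sup>2 * (q + 2) / (q + 1)\<^sup>2 \<le> 0" by simp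
    then have "b\<^sup>2 * (q + 2) \<le> 0" using q by (simp add: divide_le_0_iff)
    then have "b = 0" using q by (smt (verit) mult_pos_pos zero_less_power2)
    then show ?thesis by (simp add: b_def)
  qed
  then show ?thesis by blast
qed

text \<open>\<open>inv\<close> is meaningful only at points of the range, so the content is
  surjectivity: representing the functional \<open>riesz y\<close> means solving
  \<open>A x = y\<close>.\<close>

lemma self_adjoint_coercive_inv:
  fixes A :: "'a::{real_inner,complete_space} \<Rightarrow>\<^sub>L 'a"
  assumes "c > 0" "self_adjoint_coercive c A"
  shows "A (inv (blinfun_apply A) y) = y"
proof -
  have "surj (blinfun_apply A)"
  unfolding surj_def
  proof
    fix y
    obtain x where "\<forall>u. A x \<bullet> u = riesz y u"
      using self_adjoint_coercive_represents[OF assms] by blast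
    then have "A x = y" using vector_eq_rdot[of "A x" y] by simp
    then show "\<exists>x. y = A x" by blast
  qed
  then show ?thesis by (rule surj_f_inv_f)
qed

text \<open>The Riesz representation theorem is the case of the identity operator in the
  minimisation argument.\<close>

lemma inner_inv_riesz:
  fixes F :: "'a::{real_inner,complete_space} \<Rightarrow>\<^sub>L real"
  shows "inv riesz F \<bullet> x = F x"
proof -
  have "self_adjoint_coercive 1 (id_blinfun :: 'a \<Rightarrow>\<^sub>L 'a)"
    by (simp add: self_adjoint_coercive_def)
  from self_adjoint_coercive_represents[OF zero_less_one this, of F]
  obtain v where "\<forall>y. v \<bullet> y = F y" by auto
  then have "riesz v = F" by (intro blinfun_eqI) simp
  then have "riesz (inv riesz F) = F" by (rule f_inv_into_f[OF range_eqI[OF sym]])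
  then show ?thesis by (metis blinfun_inner_right.rep_eq)
qed

lemma self_adjoint_coercive_nonneg:
  assumes "c > 0" "self_adjoint_coercive c A"
  shows "0 \<le> blinfun_apply A x \<bullet> x"
proof -
  have "c * (x \<bullet> x) \<le> A x \<bullet> x" using assms unfolding self_adjoint_coercive_def by blast
  moreover have "0 \<le> c * (x \<bullet> x)" using assms by simp
  ultimately show ?thesis by linarith
qed

section \<open>Strong measurability and Bochner integrals\<close>

lemma borel_measurable_inner_const:
  fixes f :: "'a \<Rightarrow> 'b::real_inner"
  assumes "f \<in> borel_measurable M"
  shows "(\<lambda>t. f t \<bullet> x) \<in> borel_measurable M"
  by (rule borel_measurable_continuous_on[OF _ assms]) (intro continuous_intros)

text \<open>Without separability \<open>f - s\<close> may fail to be Borel for general Borel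
  \<open>s\<close>. A simple \<open>s\<close> splits the space into finitely many pieces, and on
  each of them the function is a continuous function of \<open>f\<close>.\<close>

lemma borel_measurable_norm_diff_simple:
  fixes f :: "'a \<Rightarrow> 'b::real_normed_vector"
  assumes f: "f \<in> borel_measurable M" and s: "simple_function M s"
  shows "(\<lambda>x. norm (f x - s x)) \<in> borel_measurable M"
proof (rule measurable_compose_countable'[where g = s and I = "s ` space M"])
  fix y
  show "(\<lambda>x. norm (f x - y)) \<in> borel_measurable M"
    by (rule borel_measurable_continuous_on[OF _ f]) (intro continuous_intros)
next
  show "s \<in> M \<rightarrow>\<^sub>M count_space (s ` space M)"
    using s by (auto simp: simple_function_def measurable_count_space_eq2)
  show "countable (s ` space M)"
    using s by (simp add: simple_functionD(1) countable_finite)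
qed

lemma strongly_measurableI:
  assumes "f \<in> borel_measurable M" "\<And>i::nat. simple_function M (s i)"
    and "AE t in M. (\<lambda>i. s i t) \<longlonglongrightarrow> f t"
  shows "strongly_measurable M f"
  using assms unfolding strongly_measurable_def by blast

lemma strongly_measurable_norm:
  assumes "strongly_measurable M f"
  shows "(\<lambda>t. norm (f t)) \<in> borel_measurable M"
  using assms by (auto simp: strongly_measurable_def intro: measurable_compose[OF _ borel_measurable_norm])

text \<open>\<open>strongly_measurable\<close> demands Borel measurability everywhere besides an
  almost everywhere limit of simple functions. Over Lebesgue measure the second property yields the
  first.\<close>

lemma borel_measurable_lebesgue_on_AE_limit:
  fixes f :: "real \<Rightarrow> 'b::metric_space"
  assumes S: "S \<in> sets lebesgue"
    and u: "\<And>i::nat. u i \<in> borel_measurable (lebesgue_on S)"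
    and lim: "AE t in lebesgue_on S. (\<lambda>i. u i t) \<longlonglongrightarrow> f t"
  shows "f \<in> borel_measurable (lebesgue_on S)"
proof -
  obtain N where N: "N \<in> null_sets (lebesgue_on S)"
      and lim: "\<And>t. t \<in> space (lebesgue_on S) - N \<Longrightarrow> (\<lambda>i. u i t) \<longlonglongrightarrow> f t"
    using AE_E3[OF lim] by blast
  define g where "g t = (if t \<in> N then undefined else f t)" for t
  have Ns: "N \<in> sets (lebesgue_on S)" using N by auto
  have g: "g \<in> borel_measurable (lebesgue_on S)"
  proof (rule borel_measurable_LIMSEQ_metric)
    show "(\<lambda>t. if t \<in> N then undefined else u i t) \<in> borel_measurable (lebesgue_on S)" for i
      using u[of i] Ns by measurable
    show "(\<lambda>i. if t \<in> N then undefined else u i t) \<longlonglongrightarrow> g t" if "t \<in> space (lebesgue_on S)" for t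
      using lim[of t] that by (auto simp: g_def)
  qed
  \<comment> \<open>Completeness of Lebesgue measure absorbs the arbitrary values of \<open>f\<close> on \<open>N\<close>.\<close>
  show ?thesis
  proof (rule measurableI)
    fix A :: "'b set" assume A: "A \<in> sets borel"
    have "f -` A \<inter> S = ((g -` A \<inter> space (lebesgue_on S)) - N) \<union> (f -` A \<inter> S \<inter> N)"
      by (auto simp: g_def)
    moreover have "(g -` A \<inter> space (lebesgue_on S)) - N \<in> sets (lebesgue_on S)"
      using measurable_sets[OF g A] Ns by blast
    moreover have "f -` A \<inter> S \<inter> N \<in> sets (lebesgue_on S)"
    proof -
      have "N \<in> null_sets lebesgue" "N \<subseteq> S" using N S by (auto simp: null_sets_restrict_space)
      then have "f -` A \<inter> S \<inter> N \<in> sets lebesgue"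
        by (intro null_sets_completion_subset[THEN null_setsD2, of _ N]) auto
      then show ?thesis using S by (auto simp: sets_restrict_space_iff)
    qed
    ultimately show "f -` A \<inter> space (lebesgue_on S) \<in> sets (lebesgue_on S)"
      by (metis sets.Un space_lebesgue_on)
  qed simp
qed

text \<open>Evaluation is jointly continuous, so the simple functions \<open>u i t (v i t)\<close>
  converge almost everywhere to \<open>U t (g t)\<close>. Borel measurability is then read off from
  this limit and not from a composition of Borel maps.\<close>

lemma strongly_measurable_blinfun_apply:
  fixes U :: "real \<Rightarrow> ('a::real_normed_vector \<Rightarrow>\<^sub>L 'b::real_normed_vector)"
  assumes S: "S \<in> sets lebesgue"
    and U: "strongly_measurable (lebesgue_on S) U" and g: "strongly_measurable (lebesgue_on S) g"
  shows "strongly_measurable (lebesgue_on S) (\<lambda>t. U t (g t))"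
proof -
  obtain u v where u: "\<And>i::nat. simple_function (lebesgue_on S) (u i)"
      and limu: "AE t in lebesgue_on S. (\<lambda>i. u i t) \<longlonglongrightarrow> U t"
      and v: "\<And>i::nat. simple_function (lebesgue_on S) (v i)"
      and limv: "AE t in lebesgue_on S. (\<lambda>i. v i t) \<longlonglongrightarrow> g t"
    using U g unfolding strongly_measurable_def by blast
  have s: "simple_function (lebesgue_on S) (\<lambda>t. u i t (v i t))" for i
    using simple_function_compose2[OF u v, where h = blinfun_apply] .
  have lim: "AE t in lebesgue_on S. (\<lambda>i. u i t (v i t)) \<longlonglongrightarrow> U t (g t)"
    using limu limv by eventually_elim (rule bounded_bilinear.tendsto[OF bounded_bilinear_blinfun_apply])
  show ?thesis
    by (rule strongly_measurableI[OF
          borel_measurable_lebesgue_on_AE_limit[OF S borel_measurable_simple_function[OF s] lim] s lim])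
qed

lemma strongly_measurable_scaleR:
  assumes "strongly_measurable M f"
  shows "strongly_measurable M (\<lambda>t. c *\<^sub>R f t)"
proof -
  obtain u where f: "f \<in> borel_measurable M" and u: "\<And>i::nat. simple_function M (u i)"
      and lim: "AE t in M. (\<lambda>i. u i t) \<longlonglongrightarrow> f t"
    using assms unfolding strongly_measurable_def by blast
  have "(\<lambda>t. c *\<^sub>R f t) \<in> borel_measurable M"
    by (rule borel_measurable_continuous_on[OF _ f]) (intro continuous_intros)
  moreover have "simple_function M (\<lambda>t. c *\<^sub>R u i t)" for i
    by (rule simple_function_compose1[OF u])
  moreover have "AE t in M. (\<lambda>i. c *\<^sub>R u i t) \<longlonglongrightarrow> c *\<^sub>R f t"
    using lim by eventually_elim (intro tendsto_intros)
  ultimately show ?thesis by (rule strongly_measurableI)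
qed

text \<open>The exceptional set is first enlarged to a measurable null set \<open>N\<close>, because
  lifting an almost everywhere statement to the product asks for a measurable cylinder over
  it.\<close>

lemma strongly_measurable_fst:
  assumes "sigma_finite_measure M" "sigma_finite_measure M'" "strongly_measurable M f"
  shows "strongly_measurable (M \<Otimes>\<^sub>M M') (\<lambda>x. f (fst x))"
proof -
  interpret pair_sigma_finite M M' using assms by (simp add: pair_sigma_finite_def)
  obtain u where f: "f \<in> borel_measurable M" and u: "\<And>i::nat. simple_function M (u i)"
      and lim: "AE t in M. (\<lambda>i. u i t) \<longlonglongrightarrow> f t"
    using assms unfolding strongly_measurable_def by blast
  obtain N where N: "N \<in> null_sets M" and lim: "\<And>t. t \<in> space M - N \<Longrightarrow> (\<lambda>i. u i t) \<longlonglongrightarrow> f t"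
    using AE_E3[OF lim] by blast
  have [measurable]: "N \<in> sets M" using N by auto
  have "AE x in M \<Otimes>\<^sub>M M'. fst x \<notin> N"
  proof (rule AE_pair_measure)
    show "{x \<in> space (M \<Otimes>\<^sub>M M'). fst x \<notin> N} \<in> sets (M \<Otimes>\<^sub>M M')" by measurable
    show "AE x in M. AE y in M'. fst (x, y) \<notin> N" using AE_not_in[OF N] by eventually_elim simp
  qed
  then have "AE x in M \<Otimes>\<^sub>M M'. (\<lambda>i. u i (fst x)) \<longlonglongrightarrow> f (fst x)"
    using AE_space by eventually_elim (auto simp: space_pair_measure intro: lim)
  then show ?thesis
    by (rule strongly_measurableI[OF measurable_compose[OF measurable_fst f]
          simple_function_comp[OF measurable_fst u]])
qed

lemma strongly_measurable_If:
  assumes f: "strongly_measurable M f" and g: "strongly_measurable M g"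
    and P: "{x\<in>space M. P x} \<in> sets M"
  shows "strongly_measurable M (\<lambda>x. if P x then f x else g x)"
proof -
  obtain u v where fm: "f \<in> borel_measurable M" and u: "\<And>i::nat. simple_function M (u i)"
      and limu: "AE t in M. (\<lambda>i. u i t) \<longlonglongrightarrow> f t"
      and gm: "g \<in> borel_measurable M" and v: "\<And>i::nat. simple_function M (v i)"
      and limv: "AE t in M. (\<lambda>i. v i t) \<longlonglongrightarrow> g t"
    using f g unfolding strongly_measurable_def by blast
  have "(\<lambda>x. if P x then f x else g x) \<in> borel_measurable M"
    by (rule measurable_If[OF fm gm P])
  moreover have "simple_function M (\<lambda>x. if P x then u i x else v i x)" for i
    by (rule simple_function_If[OF u v P])
  moreover have "AE x in M. (\<lambda>i. if P x then u i x else v i x) \<longlonglongrightarrow> (if P x then f x else g x)"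
    using limu limv by eventually_elim auto
  ultimately show ?thesis by (rule strongly_measurableI)
qed

section \<open>Bochner integrals tested against fixed vectors\<close>

lemma has_bochner_integral_simple_vector_inner:
  fixes s :: "'a \<Rightarrow> 'b::real_inner"
  assumes "simple_integrable M s"
  shows "has_bochner_integral M (\<lambda>t. s t \<bullet> x) (simple_vector_integral M s \<bullet> x)"
proof -
  have s: "simple_function M s" and fin: "emeasure M {t\<in>space M. s t \<noteq> 0} \<noteq> \<infinity>"
    using assms by (auto simp: simple_integrable_def)
  let ?E = "\<lambda>y. {t\<in>space M. s t = y}"
  have E: "?E y \<in> sets M" for y
    using simple_functionD(2)[OF s, of "{y}"] by (simp add: vimage_def Int_def conj_commute)
  have "{t\<in>space M. s t \<noteq> 0} = space M - ?E 0" by auto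
  then have "{t\<in>space M. s t \<noteq> 0} \<in> sets M" using sets.compl_sets[OF E] by simp
  then have "emeasure M (?E y) \<le> emeasure M {t\<in>space M. s t \<noteq> 0}" if "y \<noteq> 0" for y
    using that by (intro emeasure_mono) auto
  then have fin': "emeasure M (?E y) < \<infinity>" if "y \<noteq> 0" for y
    using that fin le_less_trans unfolding less_top infinity_ennreal_def by blast
  \<comment> \<open>The level set of \<open>y = 0\<close> may have infinite measure; it is harmless
    because its coefficient \<open>y \<bullet> x\<close> vanishes.\<close>
  have "has_bochner_integral M (\<lambda>t. (y \<bullet> x) * indicator (?E y) t) ((y \<bullet> x) * measure M (?E y))" for y
    by (intro has_bochner_integral_mult_right has_bochner_integral_real_indicator E fin') auto
  then have "has_bochner_integral M (\<lambda>t. \<Sum>y\<in>s ` space M. (y \<bullet> x) * indicator (?E y) t)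
      (\<Sum>y\<in>s ` space M. (y \<bullet> x) * measure M (?E y))"
    by (intro has_bochner_integral_sum)
  moreover have "(\<Sum>y\<in>s ` space M. (y \<bullet> x) * indicator (?E y) t) = s t \<bullet> x" if "t \<in> space M" for t
  proof -
    have "(\<Sum>y\<in>s ` space M. (y \<bullet> x) * indicator (?E y) t)
        = (\<Sum>y\<in>s ` space M. if y = s t then y \<bullet> x else 0)"
      using that by (intro sum.cong) (auto simp: indicator_def)
    then show ?thesis using that s by (simp add: simple_functionD(1) sum.delta)
  qed
  moreover have "(\<Sum>y\<in>s ` space M. (y \<bullet> x) * measure M (?E y)) = simple_vector_integral M s \<bullet> x"
    by (simp add: simple_vector_integral_def inner_sum_left mult.commute)
  ultimately show ?thesis by (subst has_bochner_integral_cong[OF refl _ refl]) auto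
qed

text \<open>Testing against the difference \<open>?v\<close> itself gives its squared norm, bounded
  by \<open>norm ?v\<close> times the right-hand side; one factor cancels. This avoids a common
  refinement of the level sets of \<open>s\<close> and \<open>u\<close>.\<close>

lemma norm_simple_vector_integral_diff_le:
  fixes s u :: "'a \<Rightarrow> 'b::real_inner"
  assumes s: "simple_integrable M s" and u: "simple_integrable M u"
  shows "ennreal (norm (simple_vector_integral M s - simple_vector_integral M u))
    \<le> (\<integral>\<^sup>+t. ennreal (norm (s t - u t)) \<partial>M)"
proof -
  let ?v = "simple_vector_integral M s - simple_vector_integral M u"
  have I: "has_bochner_integral M (\<lambda>t. s t \<bullet> ?v - u t \<bullet> ?v) (?v \<bullet> ?v)"
    using has_bochner_integral_diff[OF has_bochner_integral_simple_vector_inner[OF s, of ?v]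
        has_bochner_integral_simple_vector_inner[OF u, of ?v]]
    by (simp add: inner_diff_left)
  have "ennreal (norm ?v) * ennreal (norm ?v) = ennreal (norm (?v \<bullet> ?v))"
    by (simp add: power2_norm_eq_inner[symmetric] power2_eq_square ennreal_mult)
  also have "\<dots> \<le> (\<integral>\<^sup>+t. ennreal (norm (s t \<bullet> ?v - u t \<bullet> ?v)) \<partial>M)"
    by (rule has_bochner_integral_norm_bound[OF I])
  also have "\<dots> \<le> (\<integral>\<^sup>+t. ennreal (norm ?v) * ennreal (norm (s t - u t)) \<partial>M)"
    by (intro nn_integral_mono)
      (simp add: ennreal_mult[symmetric] inner_diff_left[symmetric] Cauchy_Schwarz_ineq2 mult.commute)
  also have "\<dots> = ennreal (norm ?v) * (\<integral>\<^sup>+t. ennreal (norm (s t - u t)) \<partial>M)"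
  proof (rule nn_integral_cmult)
    have "simple_function M s" "simple_function M u"
      using s u by (auto simp: simple_integrable_def)
    then have "simple_function M (\<lambda>t. norm (s t - u t))"
      by (rule simple_function_compose2[where h = "\<lambda>a b. norm (a - b)"])
    then show "(\<lambda>t. ennreal (norm (s t - u t))) \<in> borel_measurable M"
      by (rule measurable_compose[OF borel_measurable_simple_function measurable_ennreal])
  qed
  finally show ?thesis
    by (cases "?v = 0") (simp_all add: ennreal_mult_le_mult_iff)
qed

text \<open>By Cauchy-Schwarz, convergence of the simple approximants in mean survives the inner
  product with \<open>x\<close>, so the scalar integrals converge as well.\<close>

lemma bochner_integral_inner:
  fixes f :: "'a \<Rightarrow> 'b::real_inner"
  assumes "bochner_integral M f v"
  shows "has_bochner_integral M (\<lambda>t. f t \<bullet> x) (v \<bullet> x)"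
proof -
  obtain s where f: "f \<in> borel_measurable M" and s: "\<And>i::nat. simple_integrable M (s i)"
    and lim: "(\<lambda>i. \<integral>\<^sup>+t. ennreal (norm (f t - s i t)) \<partial>M) \<longlonglongrightarrow> 0"
    and v: "(\<lambda>i. simple_vector_integral M (s i)) \<longlonglongrightarrow> v"
    using assms unfolding bochner_integral_def by blast
  have fx: "(\<lambda>t. f t \<bullet> x) \<in> borel_measurable M" by (rule borel_measurable_inner_const[OF f])
  have si: "integrable M (\<lambda>t. s i t \<bullet> x)" "(\<integral>t. s i t \<bullet> x \<partial>M) = simple_vector_integral M (s i) \<bullet> x" for i
    using has_bochner_integral_simple_vector_inner[OF s, of i x]
    by (auto simp: has_bochner_integral_iff)
  have meas: "(\<lambda>t. ennreal (norm (f t - s i t))) \<in> borel_measurable M" for i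
    using s[of i] by (intro measurable_compose[OF _ measurable_ennreal]
        borel_measurable_norm_diff_simple f) (simp add: simple_integrable_def)
  have bound: "(\<integral>\<^sup>+t. ennreal (norm (s i t \<bullet> x - f t \<bullet> x)) \<partial>M)
      \<le> ennreal (norm x) * (\<integral>\<^sup>+t. ennreal (norm (f t - s i t)) \<partial>M)" for i
  proof -
    have "(\<integral>\<^sup>+t. ennreal (norm (s i t \<bullet> x - f t \<bullet> x)) \<partial>M)
        \<le> (\<integral>\<^sup>+t. ennreal (norm x) * ennreal (norm (f t - s i t)) \<partial>M)"
      by (intro nn_integral_mono)
        (simp add: ennreal_mult[symmetric] inner_diff_left[symmetric] norm_minus_commute[of "f _"]
          mult.commute[of "norm x"] Cauchy_Schwarz_ineq2)
    also have "\<dots> = ennreal (norm x) * (\<integral>\<^sup>+t. ennreal (norm (f t - s i t)) \<partial>M)"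
      by (rule nn_integral_cmult[OF meas])
    finally show ?thesis .
  qed
  have "(\<lambda>i. ennreal (norm x) * (\<integral>\<^sup>+t. ennreal (norm (f t - s i t)) \<partial>M)) \<longlonglongrightarrow> ennreal (norm x) * 0"
    by (intro ennreal_tendsto_cmult lim) simp
  then have lim0: "(\<lambda>i. ennreal (norm x) * (\<integral>\<^sup>+t. ennreal (norm (f t - s i t)) \<partial>M)) \<longlonglongrightarrow> 0" by simp
  have lim': "(\<lambda>i. \<integral>\<^sup>+t. ennreal (norm (s i t \<bullet> x - f t \<bullet> x)) \<partial>M) \<longlonglongrightarrow> 0"
    by (rule tendsto_sandwich[OF always_eventually always_eventually tendsto_const lim0])
      (use bound in simp_all)
  \<comment> \<open>A single approximant at finite distance already makes
    \<open>f t \<bullet> x\<close> integrable, as a difference of integrable functions.\<close>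
  then have "eventually (\<lambda>i. (\<integral>\<^sup>+t. ennreal (norm (s i t \<bullet> x - f t \<bullet> x)) \<partial>M) < 1) sequentially"
    by (rule order_tendstoD) simp
  then obtain i where i: "(\<integral>\<^sup>+t. ennreal (norm (s i t \<bullet> x - f t \<bullet> x)) \<partial>M) < 1"
    by (auto simp: eventually_sequentially)
  have "integrable M (\<lambda>t. s i t \<bullet> x - f t \<bullet> x)"
  proof (rule integrableI_bounded)
    show "(\<lambda>t. s i t \<bullet> x - f t \<bullet> x) \<in> borel_measurable M" using fx si(1)[of i] by measurable
    show "(\<integral>\<^sup>+t. ennreal (norm (s i t \<bullet> x - f t \<bullet> x)) \<partial>M) < \<infinity>"
      using i by (auto intro: less_trans[OF _ ennreal_one_less_top])
  qed
  from Bochner_Integration.integrable_diff[OF si(1)[of i] this] have int: "integrable M (\<lambda>t. f t \<bullet> x)" by simp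
  have "(\<lambda>i. \<integral>t. s i t \<bullet> x \<partial>M) \<longlonglongrightarrow> (\<integral>t. f t \<bullet> x \<partial>M)"
    by (rule tendsto_L1_int[OF si(1) int lim'])
  moreover have "(\<lambda>i. \<integral>t. s i t \<bullet> x \<partial>M) \<longlonglongrightarrow> v \<bullet> x"
    unfolding si by (intro tendsto_intros v)
  ultimately show ?thesis using int by (simp add: has_bochner_integral_iff LIMSEQ_unique)
qed

text \<open>\<open>bochner\<close> is a definite description, so it can be evaluated only after
  uniqueness; two vectors with the same inner products coincide.\<close>

lemma bochner_eqI:
  fixes f :: "'a \<Rightarrow> 'b::real_inner"
  assumes f: "bochner_integrable M f" and w: "\<And>x. (\<integral>t. f t \<bullet> x \<partial>M) = w \<bullet> x"
  shows "bochner M f = w"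
proof -
  obtain v where v: "bochner_integral M f v" using f by (auto simp: bochner_integrable_def)
  have eq: "u = w" if "bochner_integral M f u" for u
    using bochner_integral_inner[OF that] w
    by (metis has_bochner_integral_integral_eq vector_eq_rdot)
  show ?thesis unfolding bochner_def
    by (rule the_equality) (use eq v in auto)
qed

lemma bochner_inner:
  fixes f :: "'a \<Rightarrow> 'b::real_inner"
  assumes f: "bochner_integrable M f"
  shows "integrable M (\<lambda>t. f t \<bullet> x)" "(\<integral>t. f t \<bullet> x \<partial>M) = bochner M f \<bullet> x"
proof -
  obtain v where v: "bochner_integral M f v" using f by (auto simp: bochner_integrable_def)
  then have "bochner M f = v"
    using f by (intro bochner_eqI) (auto dest: bochner_integral_inner has_bochner_integral_integral_eq)
  with bochner_integral_inner[OF v, of x]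
  show "integrable M (\<lambda>t. f t \<bullet> x)" "(\<integral>t. f t \<bullet> x \<partial>M) = bochner M f \<bullet> x"
    by (auto simp: has_bochner_integral_iff)
qed

text \<open>The sufficient half of Bochner's criterion. Finiteness of the measure makes every simple
  function integrable, dominated convergence gives approximation in mean, and completeness provides
  the limit of the simple integrals.\<close>

lemma (in finite_measure) bochner_integrable_strongly_measurable:
  fixes f :: "'a \<Rightarrow> 'b::{real_inner,complete_space}"
  assumes sm: "strongly_measurable M f" and fin: "(\<integral>\<^sup>+t. ennreal (norm (f t)) \<partial>M) < \<infinity>"
  shows "bochner_integrable M f"
proof -
  obtain s where f: "f \<in> borel_measurable M" and s: "\<And>i::nat. simple_function M (s i)"
    and lim: "AE t in M. (\<lambda>i. s i t) \<longlonglongrightarrow> f t"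
    using sm unfolding strongly_measurable_def by blast
  have nf: "(\<lambda>t. norm (f t)) \<in> borel_measurable M"
    by (rule measurable_compose[OF f borel_measurable_norm])
  \<comment> \<open>Truncation provides the dominating function \<open>3 * norm (f t)\<close>.\<close>
  define u where "u i t = (if norm (s i t) \<le> 2 * norm (f t) then s i t else 0)" for i t
  have u: "simple_function M (u i)" for i
    unfolding u_def
  proof (intro simple_function_If s simple_function_const)
    have [measurable]: "(\<lambda>t. norm (s i t)) \<in> borel_measurable M"
      by (rule borel_measurable_simple_function[OF simple_function_compose1[OF s]])
    note nf[measurable]
    show "{t \<in> space M. norm (s i t) \<le> 2 * norm (f t)} \<in> sets M" by measurable
  qed
  then have si: "simple_integrable M (u i)" for i
    by (simp add: simple_integrable_def)
  have ulim: "(\<lambda>i. u i t) \<longlonglongrightarrow> f t" if l: "(\<lambda>i. s i t) \<longlonglongrightarrow> f t" for t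
  \<comment> \<open>At a zero of \<open>f\<close> the truncation forces \<open>u i t = 0\<close>;
    elsewhere \<open>norm (s i t)\<close> is eventually below \<open>2 * norm (f t)\<close> and the
    truncation becomes inactive.\<close>
  proof (cases "f t = 0")
    case True
    then have "u i t = 0" for i by (simp add: u_def)
    then show ?thesis using True by simp
  next
    case False
    have "(\<lambda>i. norm (s i t)) \<longlonglongrightarrow> norm (f t)" by (rule tendsto_norm[OF l])
    then have "eventually (\<lambda>i. norm (s i t) < 2 * norm (f t)) sequentially"
      by (rule order_tendstoD) (use False in simp)
    then have "eventually (\<lambda>i. u i t = s i t) sequentially"
      by eventually_elim (simp add: u_def)
    then show ?thesis using l by (simp add: tendsto_cong)
  qed
  have meas: "(\<lambda>t. ennreal (norm (f t - u i t))) \<in> borel_measurable M" for i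
    by (intro measurable_compose[OF _ measurable_ennreal] borel_measurable_norm_diff_simple f u)
  have "(\<lambda>i. \<integral>\<^sup>+t. ennreal (norm (f t - u i t)) \<partial>M) \<longlonglongrightarrow> (\<integral>\<^sup>+t. 0 \<partial>M)"
  proof (rule nn_integral_dominated_convergence)
    show "AE t in M. ennreal (norm (f t - u i t)) \<le> 3 * ennreal (norm (f t))" for i
    proof (rule AE_I2)
      fix t
      have "norm (f t - u i t) \<le> 3 * norm (f t)"
        using norm_triangle_ineq4[of "f t" "u i t"] norm_ge_zero[of "f t"] by (auto simp: u_def)
      then have "ennreal (norm (f t - u i t)) \<le> ennreal (3 * norm (f t))" by (rule ennreal_leI)
      then show "ennreal (norm (f t - u i t)) \<le> 3 * ennreal (norm (f t))" by (simp add: ennreal_mult)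
    qed
    show "(\<lambda>t. 3 * ennreal (norm (f t))) \<in> borel_measurable M" using nf by measurable
    show "(\<integral>\<^sup>+t. 3 * ennreal (norm (f t)) \<partial>M) < \<infinity>"
      using nf fin by (subst nn_integral_cmult) (auto simp: ennreal_mult_less_top)
    show "AE t in M. (\<lambda>i. ennreal (norm (f t - u i t))) \<longlonglongrightarrow> 0"
      using lim
    proof eventually_elim
      case (elim t)
      have "(\<lambda>i. norm (f t - u i t)) \<longlonglongrightarrow> norm (f t - f t)"
        by (intro tendsto_intros ulim elim)
      then have "(\<lambda>i. ennreal (norm (f t - u i t))) \<longlonglongrightarrow> ennreal 0"
        by (intro tendsto_ennrealI) simp
      then show ?case by simp
    qed
  qed (use meas in auto)
  then have L: "(\<lambda>i. \<integral>\<^sup>+t. ennreal (norm (f t - u i t)) \<partial>M) \<longlonglongrightarrow> 0" by simp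
  have diff: "ennreal (norm (simple_vector_integral M (u i) - simple_vector_integral M (u k)))
     \<le> (\<integral>\<^sup>+t. ennreal (norm (f t - u i t)) \<partial>M) + (\<integral>\<^sup>+t. ennreal (norm (f t - u k t)) \<partial>M)" for i k
  proof -
    have "(\<integral>\<^sup>+t. ennreal (norm (u i t - u k t)) \<partial>M)
       \<le> (\<integral>\<^sup>+t. ennreal (norm (f t - u i t)) + ennreal (norm (f t - u k t)) \<partial>M)"
    proof (rule nn_integral_mono)
      fix t
      have "norm (u i t - u k t) \<le> norm (f t - u i t) + norm (f t - u k t)"
        using norm_triangle_ineq4[of "f t - u k t" "f t - u i t"] by simp
      then show "ennreal (norm (u i t - u k t)) \<le> ennreal (norm (f t - u i t)) + ennreal (norm (f t - u k t))"
        by (metis ennreal_leI ennreal_plus norm_ge_zero)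
    qed
    also have "\<dots> = (\<integral>\<^sup>+t. ennreal (norm (f t - u i t)) \<partial>M) + (\<integral>\<^sup>+t. ennreal (norm (f t - u k t)) \<partial>M)"
      by (rule nn_integral_add[OF meas meas])
    finally show ?thesis using norm_simple_vector_integral_diff_le[OF si si] order_trans by blast
  qed
  have "Cauchy (\<lambda>i. simple_vector_integral M (u i))"
  proof (rule metric_CauchyI)
    fix e :: real assume e: "e > 0"
    have "eventually (\<lambda>i. (\<integral>\<^sup>+t. ennreal (norm (f t - u i t)) \<partial>M) < ennreal (e/2)) sequentially"
      using L by (rule order_tendstoD) (use e in simp)
    then obtain N where N: "\<And>i. i \<ge> N \<Longrightarrow> (\<integral>\<^sup>+t. ennreal (norm (f t - u i t)) \<partial>M) < ennreal (e/2)"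
      by (auto simp: eventually_sequentially)
    have "dist (simple_vector_integral M (u i)) (simple_vector_integral M (u k)) < e"
      if "i \<ge> N" "k \<ge> N" for i k
    proof -
      have "ennreal (norm (simple_vector_integral M (u i) - simple_vector_integral M (u k)))
         < ennreal (e/2) + ennreal (e/2)"
        using diff add_strict_mono[OF N[OF that(1)] N[OF that(2)]] by (rule le_less_trans)
      also have "\<dots> = ennreal e" using e by (subst ennreal_plus[symmetric]) auto
      finally show ?thesis using e by (simp add: dist_norm ennreal_less_iff)
    qed
    then show "\<exists>N. \<forall>i\<ge>N. \<forall>k\<ge>N. dist (simple_vector_integral M (u i)) (simple_vector_integral M (u k)) < e"
      by blast
  qed
  then obtain v where "(\<lambda>i. simple_vector_integral M (u i)) \<longlonglongrightarrow> v"
    using Cauchy_convergent_iff convergent_def by blast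
  then show ?thesis
    unfolding bochner_integrable_def bochner_integral_def using f si L by blast
qed

lemma (in finite_measure) bochner_scaleR:
  fixes f :: "'a \<Rightarrow> 'b::{real_inner,complete_space}"
  assumes sm: "strongly_measurable M f" and fin: "(\<integral>\<^sup>+t. ennreal (norm (f t)) \<partial>M) < \<infinity>"
  shows "bochner M (\<lambda>t. c *\<^sub>R f t) = c *\<^sub>R bochner M f"
proof (rule bochner_eqI)
  have f: "bochner_integrable M f"
    by (rule bochner_integrable_strongly_measurable[OF sm fin])
  have "(\<lambda>t. norm (f t)) \<in> borel_measurable M"
    by (rule strongly_measurable_norm[OF sm])
  then have "(\<integral>\<^sup>+t. ennreal (norm (c *\<^sub>R f t)) \<partial>M) = ennreal \<bar>c\<bar> * (\<integral>\<^sup>+t. ennreal (norm (f t)) \<partial>M)"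
    by (simp add: ennreal_mult nn_integral_cmult)
  also have "\<dots> < \<infinity>" using fin by (simp add: ennreal_mult_less_top)
  finally show "bochner_integrable M (\<lambda>t. c *\<^sub>R f t)"
    by (intro bochner_integrable_strongly_measurable strongly_measurable_scaleR sm)
  show "(\<integral>t. (c *\<^sub>R f t) \<bullet> x \<partial>M) = (c *\<^sub>R bochner M f) \<bullet> x" for x
    using bochner_inner[OF f, of x] by simp
qed

section \<open>Two-valued noise\<close>

text \<open>The sigma-algebra is all of \<open>UNIV\<close>, so every function on the sample type is
  measurable.\<close>

definition fair_pair :: "'w \<Rightarrow> 'w \<Rightarrow> 'w measure" where
  "fair_pair x y = measure_pmf (pmf_of_set {x, y})"

lemma fair_pair_simps [simp]: "sets (fair_pair x y) = UNIV" "space (fair_pair x y) = UNIV"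
  by (simp_all add: fair_pair_def)

lemma prob_space_fair_pair: "prob_space (fair_pair x y)"
  unfolding fair_pair_def by (rule measure_pmf.prob_space_axioms)

lemma nn_integral_fair_pair:
  assumes "x \<noteq> y" shows "(\<integral>\<^sup>+\<omega>. f \<omega> \<partial>fair_pair x y) = (f x + f y) / 2"
  using assms unfolding fair_pair_def by (simp add: nn_integral_pmf_of_set)

lemma integrable_fair_pair: "integrable (fair_pair x y) (f :: _ \<Rightarrow> real)"
  unfolding fair_pair_def by (rule integrable_measure_pmf_finite) simp

lemma integral_fair_pair:
  assumes "x \<noteq> y" shows "(\<integral>\<omega>. f \<omega> \<partial>fair_pair x y) = (f x + f y) / (2 :: real)"
  using assms unfolding fair_pair_def by (simp add: integral_pmf_of_set)

text \<open>A random sign times the deterministic profile \<open>g\<close>: under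
  \<open>fair_pair x y\<close> the only other outcome with positive mass is
  \<open>y\<close>.\<close>

definition flip :: "'w \<Rightarrow> (real \<Rightarrow> 'h::real_normed_vector) \<Rightarrow> real \<Rightarrow> 'w \<Rightarrow> 'h" where
  "flip x g t \<omega> = (if \<omega> = x then g t else - g t)"

lemma norm_flip [simp]: "norm (flip x g t \<omega>) = norm (g t)"
  by (simp add: flip_def)

lemma strongly_measurable_lebesgue_on_pair_flip:
  assumes S: "S \<in> lmeasurable" and g: "strongly_measurable (lebesgue_on S) g"
  shows "strongly_measurable (lebesgue_on S \<Otimes>\<^sub>M fair_pair x y) (\<lambda>(t, \<omega>). flip x g t \<omega>)"
proof -
  have sf: "sigma_finite_measure (lebesgue_on S)" "sigma_finite_measure (fair_pair x y)"
    using finite_measure_lebesgue_on[OF S] prob_space_fair_pair[of x y]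
    by (simp_all add: finite_measure_def prob_space_def)
  have "{z \<in> space (lebesgue_on S \<Otimes>\<^sub>M fair_pair x y). snd z = x} \<in> sets (lebesgue_on S \<Otimes>\<^sub>M fair_pair x y)"
  proof -
    have "snd \<in> lebesgue_on S \<Otimes>\<^sub>M fair_pair x y \<rightarrow>\<^sub>M fair_pair x y" by (rule measurable_snd)
    from measurable_sets[OF this, of "{x}"] show ?thesis
      by (simp add: vimage_def Int_def conj_commute)
  qed
  moreover have "strongly_measurable (lebesgue_on S) (\<lambda>t. (-1) *\<^sub>R g t)"
    by (rule strongly_measurable_scaleR[OF g])
  ultimately have "strongly_measurable (lebesgue_on S \<Otimes>\<^sub>M fair_pair x y)
      (\<lambda>z. if snd z = x then g (fst z) else (-1) *\<^sub>R g (fst z))"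
    by (intro strongly_measurable_If strongly_measurable_fst[OF sf] g)
  moreover have "(\<lambda>z. if snd z = x then g (fst z) else (-1) *\<^sub>R g (fst z)) = (\<lambda>(t, \<omega>). flip x g t \<omega>)"
    by (auto simp: flip_def)
  ultimately show ?thesis by simp
qed

text \<open>Opposite values with equal weights cancel in the mean, while the norm does not depend on
  the outcome, so the expectation of its square collapses.\<close>

lemma flip_noise:
  fixes g :: "real \<Rightarrow> 'h::{real_inner,complete_space}"
  assumes xy: "x \<noteq> y" and g: "strongly_measurable (lebesgue_on {0..T}) g"
    and fin: "(\<integral>\<^sup>+t. ennreal ((norm (g t))\<^sup>2) \<partial>lebesgue_on {0..T}) < \<infinity>"
  shows "noise T (fair_pair x y) (flip x g)"
  unfolding noise_def
proof (intro conjI ballI)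
  interpret P: prob_space "fair_pair x y" by (rule prob_space_fair_pair)
  show "strongly_measurable (lebesgue_on {0..T} \<Otimes>\<^sub>M fair_pair x y) (\<lambda>(t, \<omega>). flip x g t \<omega>)"
    by (intro strongly_measurable_lebesgue_on_pair_flip g) simp
  show I: "bochner_integrable (fair_pair x y) (flip x g t)" for t
  proof (rule P.bochner_integrable_strongly_measurable)
    have "finite (range (flip x g t))"
      by (rule finite_subset[of _ "{g t, - g t}"]) (auto simp: flip_def)
    then have s: "simple_function (fair_pair x y) (flip x g t)"
      by (simp add: simple_function_def)
    then show "strongly_measurable (fair_pair x y) (flip x g t)"
      by (intro strongly_measurableI[OF borel_measurable_simple_function[OF s] s]) simp
    show "(\<integral>\<^sup>+\<omega>. ennreal (norm (flip x g t \<omega>)) \<partial>fair_pair x y) < \<infinity>"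
      by (simp add: P.emeasure_space_1[simplified])
  qed
  show "bochner (fair_pair x y) (flip x g t) = 0" for t
    using xy by (intro bochner_eqI I) (simp add: integral_fair_pair flip_def)
  show "(\<integral>\<^sup>+t. \<integral>\<^sup>+\<omega>. ennreal ((norm (flip x g t \<omega>))\<^sup>2) \<partial>fair_pair x y \<partial>lebesgue_on {0..T}) < \<infinity>"
    using fin by (simp add: P.emeasure_space_1[simplified])
qed (rule prob_space_fair_pair)

text \<open>The sign enters both factors and squares to one, which leaves a rank-one
  operator.\<close>

lemma flip_correlation_operator:
  fixes g :: "real \<Rightarrow> 'h::real_inner"
  assumes "x \<noteq> y"
  shows "\<exists>R. correlation_operator T (fair_pair x y) (flip x g) R"
proof -
  have bl: "bounded_linear (\<lambda>h. (g t \<bullet> h) *\<^sub>R g s)" for t s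
    by (intro bounded_linear_compose[OF bounded_linear_scaleR_left bounded_linear_inner_right])
  have "correlation_operator T (fair_pair x y) (flip x g) (\<lambda>t s. Blinfun (\<lambda>h. (g t \<bullet> h) *\<^sub>R g s))"
    using assms unfolding correlation_operator_def
    by (auto simp: integral_fair_pair integrable_fair_pair bounded_linear_Blinfun_apply[OF bl] flip_def)
  then show ?thesis by blast
qed

text \<open>The quadratic form of \<open>Q t\<close> is even, hence constant over outcomes.
  \<open>G1\<close> is a set of correlation operators, and the process itself witnesses membership
  of its own.\<close>

lemma flip_in_G1:
  fixes g :: "real \<Rightarrow> 'h::{real_inner,complete_space}" and Q :: "real \<Rightarrow> ('h \<Rightarrow>\<^sub>L 'h)"
  assumes xy: "x \<noteq> (y :: 'w)" and g: "strongly_measurable (lebesgue_on {0..T}) g"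
    and fin: "(\<integral>\<^sup>+t. ennreal ((norm (g t))\<^sup>2) \<partial>lebesgue_on {0..T}) < \<infinity>"
    and Q: "(\<integral>\<^sup>+t. ennreal (Q t (g t) \<bullet> g t) \<partial>lebesgue_on {0..T}) \<le> ennreal (c\<^sup>2)"
  shows "\<exists>R\<in>G1 TYPE('w) T Q c. correlation_operator T (fair_pair x y) (flip x g) R"
proof -
  interpret P: prob_space "fair_pair x y" by (rule prob_space_fair_pair)
  have "Q t (flip x g t \<omega>) \<bullet> flip x g t \<omega> = Q t (g t) \<bullet> g t" for t \<omega>
    by (simp add: flip_def blinfun.minus_right)
  then have "(\<integral>\<^sup>+t. \<integral>\<^sup>+\<omega>. ennreal (Q t (flip x g t \<omega>) \<bullet> flip x g t \<omega>) \<partial>fair_pair x y \<partial>lebesgue_on {0..T})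
      \<le> ennreal (c\<^sup>2)"
    using Q by (simp add: P.emeasure_space_1[simplified])
  then show ?thesis
    using flip_correlation_operator[OF xy] flip_noise[OF xy g fin] unfolding G1_def by blast
qed

section \<open>The Neumann problem and the lower bound\<close>

context neumann_problem
begin

text \<open>A vector orthogonal to the dense image of the kernel is zero. This is what makes the
  \<open>inv\<close> in \<open>N0\<close> return the intended element.\<close>

lemma pivot_embedding_injective: "inj (pivot_embedding j \<gamma>)"
proof (rule injI)
  fix g h assume eq: "pivot_embedding j \<gamma> g = pivot_embedding j \<gamma> h"
  let ?K = "{\<psi>. blinfun_apply \<gamma> \<psi> = 0}"
  have "(g - h) \<bullet> j \<psi> = 0" if "\<psi> \<in> ?K" for \<psi>
    using fun_cong[OF eq, of \<psi>] that by (simp add: pivot_embedding_def inner_diff_left)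
  then have "blinfun_apply j ` ?K \<subseteq> {y. (g - h) \<bullet> y = 0}" by auto
  then have "closure (blinfun_apply j ` ?K) \<subseteq> {y. (g - h) \<bullet> y = 0}"
    by (rule closure_minimal) (intro closed_Collect_eq continuous_intros)
  then have "(g - h) \<bullet> (g - h) = 0" using kernel_dense by blast
  then show "g = h" by simp
qed

lemma dom_N_iff: "\<phi> \<in> dom_N j a \<gamma> \<longleftrightarrow> (\<exists>g. N_op a \<gamma> \<phi> = pivot_embedding j \<gamma> g)"
  by (auto simp: dom_N_def)

lemma N0_eq: "N_op a \<gamma> \<phi> = pivot_embedding j \<gamma> g \<Longrightarrow> N0 j a \<gamma> \<phi> = g"
  using pivot_embedding_injective by (simp add: N0_def)

lemma solves_neumann_scaleR:
  assumes "solves_neumann j a \<gamma> \<delta> g h \<phi>"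
  shows "solves_neumann j a \<gamma> \<delta> (c *\<^sub>R g) (c *\<^sub>R h) (c *\<^sub>R \<phi>)"
proof -
  interpret bounded_bilinear a by (rule form_bounded)
  obtain g' where g': "N_op a \<gamma> \<phi> = pivot_embedding j \<gamma> g'"
    using assms by (auto simp: solves_neumann_def dom_N_iff)
  then have "g' = g" using assms N0_eq by (auto simp: solves_neumann_def)
  then have "a \<phi> \<psi> = g \<bullet> j \<psi>" if "blinfun_apply \<gamma> \<psi> = 0" for \<psi>
    using fun_cong[OF g', of \<psi>] that by (simp add: N_op_def pivot_embedding_def)
  then have eq: "N_op a \<gamma> (c *\<^sub>R \<phi>) = pivot_embedding j \<gamma> (c *\<^sub>R g)"
    by (auto simp: N_op_def pivot_embedding_def scaleR_left restrict_def)
  have "\<delta> (c *\<^sub>R \<phi>) = c *\<^sub>R \<delta> \<phi>"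
    using green assms by (simp add: green_operator_def solves_neumann_def)
  then show ?thesis
    using assms eq N0_eq[OF eq] by (auto simp: solves_neumann_def dom_N_iff)
qed

text \<open>The equation for \<open>N\<close> speaks of test functions in the kernel of
  \<open>\<gamma>\<close> only; the Green formula extends it to all of them, so that
  \<open>p l\<close> and \<open>z l\<close> can be tested against each other.\<close>

lemma solves_neumann_form:
  assumes "solves_neumann j a \<gamma> \<delta> g h \<phi>"
  shows "a \<phi> \<psi> = g \<bullet> j \<psi> + h (\<gamma> \<psi>)"
  using assms green by (auto simp: solves_neumann_def green_operator_def)

text \<open>The difference of two solutions, tested with itself, has zero energy, and coercivity
  makes it vanish.\<close>

lemma solves_neumann_unique:
  assumes "solves_neumann j a \<gamma> \<delta> g h \<phi>" "solves_neumann j a \<gamma> \<delta> g h \<phi>'"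
  shows "\<phi> = \<phi>'"
proof -
  interpret bounded_bilinear a by (rule form_bounded)
  obtain \<alpha> :: real where \<alpha>: "\<alpha> \<noteq> 0" "\<And>\<phi>. a \<phi> \<phi> \<ge> \<alpha>\<^sup>2 * (\<phi> \<bullet> \<phi>)" using form_coercive by blast
  have "a (\<phi> - \<phi>') (\<phi> - \<phi>') = 0"
    using solves_neumann_form[OF assms(1)] solves_neumann_form[OF assms(2)] by (simp add: diff_left)
  then have "\<alpha>\<^sup>2 * ((\<phi> - \<phi>') \<bullet> (\<phi> - \<phi>')) \<le> 0" using \<alpha>(2)[of "\<phi> - \<phi>'"] by simp
  then have "(\<phi> - \<phi>') \<bullet> (\<phi> - \<phi>') \<le> 0" using \<alpha>(1) by (simp add: mult_le_0_iff)
  then show ?thesis by (metis inner_gt_zero_iff not_less right_minus_eq)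
qed

lemma state_eq:
  assumes "solves_neumann j a \<gamma> \<delta> (blinfun_apply B1 f1) (blinfun_apply B0 f0) \<phi>"
  shows "state j a \<gamma> \<delta> B0 B1 f0 f1 = \<phi>"
  unfolding state_def using assms solves_neumann_unique by (blast intro: the_equality)

end

text \<open>The axioms are symmetric under exchanging the arguments of \<open>a\<close> together
  with \<open>\<delta>\<close> and \<open>\<delta>p\<close>, so results for \<open>N\<close> also
  serve the equation of \<open>z\<close>.\<close>

lemma neumann_problem_transposed:
  assumes "neumann_problem j k a \<gamma> \<delta> \<delta>p"
  shows "neumann_problem j k (transposed a) \<gamma> \<delta>p \<delta>"
  using assms unfolding neumann_problem_def by (auto intro: bounded_bilinear.flip)

text \<open>
  Two instances add up to \<open>2 * (x + y) - (A + D)\<close>, which is at least \<open>A + D\<close> as soon as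
  \<open>A + D \<le> x + y\<close>; degenerate \<open>A = 0\<close> needs no special treatment.
\<close>

lemma exists_scaling_square_ge:
  fixes A x :: real
  assumes "A \<ge> 0" "x \<ge> 0"
  shows "\<exists>s. s\<^sup>2 * A \<le> 1 \<and> s\<^sup>2 * x\<^sup>2 \<ge> 2 * x - A"
proof (cases "A = 0")
  case True
  show ?thesis
  proof (cases "x = 0")
    case False
    \<comment> \<open>For \<open>A = 0\<close> the constraint is vacuous, and
      \<open>s\<^sup>2 = 2 / x\<close> attains the required value exactly.\<close>
    then have "(sqrt (2 / x))\<^sup>2 * x\<^sup>2 = 2 * x" using assms by (simp add: power2_eq_square)
    then show ?thesis using True by (intro exI[of _ "sqrt (2 / x)"]) simp
  qed (use True in simp)
next
  case False
  then have A: "A > 0" using assms by simp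
  \<comment> \<open>The witness saturates the constraint, \<open>s\<^sup>2 = 1 / A\<close>; the
    claim is then that \<open>x\<^sup>2 / A\<close> lies above its tangent at
    \<open>x = A\<close>.\<close>
  have "0 \<le> (x - A)\<^sup>2 / A" using A by simp
  also have "\<dots> = x\<^sup>2 / A - (2 * x - A)" using A by (simp add: field_simps power2_eq_square)
  finally show ?thesis using A by (intro exI[of _ "sqrt (1 / A)"]) simp
qed

text \<open>The two vectors are \<open>s *\<^sub>R (v - w)\<close> minus or plus
  \<open>r *\<^sub>R w\<close>, so this is the parallelogram identity.\<close>

lemma mean_square_norm_eq:
  fixes v w :: "'a::real_inner"
  shows "((norm (s *\<^sub>R v - (s + r) *\<^sub>R w))\<^sup>2 + (norm (s *\<^sub>R v - (s - r) *\<^sub>R w))\<^sup>2) / 2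
     = s\<^sup>2 * (norm (v - w))\<^sup>2 + r\<^sup>2 * (norm w)\<^sup>2"
  unfolding power2_norm_eq_inner
  by (simp add: inner_simps inner_commute[of w v] power2_eq_square field_simps)

lemma inner_observation_density:
  fixes C :: "real \<Rightarrow> ('a::{real_inner,complete_space} \<Rightarrow>\<^sub>L 'b::real_inner)"
  shows "observation_density C Q x t \<bullet> y = Q t (C t x) \<bullet> C t y"
  by (simp add: observation_density_def inner_inv_riesz adjoint_op.rep_eq)

text \<open>For either sign the observation is \<open>s + r\<close> or \<open>s - r\<close> times
  \<open>C t \<phi>\<close>, and this factor comes out of the integral.\<close>

lemma mean_square_error_flip:
  fixes U :: "real \<Rightarrow> ('h::real_inner \<Rightarrow>\<^sub>L 'v::{real_inner,complete_space})"
    and C :: "real \<Rightarrow> ('a::real_inner \<Rightarrow>\<^sub>L 'h)"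
    and V :: "'a \<Rightarrow>\<^sub>L 'v"
  assumes xy: "x \<noteq> y"
    and sm: "strongly_measurable (lebesgue_on {0..T}) (\<lambda>t. blinfun_apply (U t) (C t \<phi>))"
    and fin: "(\<integral>\<^sup>+t. ennreal (norm (U t (C t \<phi>))) \<partial>lebesgue_on {0..T}) < \<infinity>"
  defines "w \<equiv> bochner (lebesgue_on {0..T}) (\<lambda>t. blinfun_apply (U t) (C t \<phi>))"
  shows "mean_square_error T C V U (s *\<^sub>R \<phi>) (fair_pair x y) (flip x (\<lambda>t. r *\<^sub>R C t \<phi>))
    = ereal (s\<^sup>2 * (norm (V \<phi> - w))\<^sup>2 + r\<^sup>2 * (norm w)\<^sup>2)"
proof -
  interpret finite_measure "lebesgue_on {0..T}" by (rule finite_measure_lebesgue_on) simp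
  have "bochner (lebesgue_on {0..T}) (\<lambda>t. U t (C t (s *\<^sub>R \<phi>) + flip x (\<lambda>t. r *\<^sub>R C t \<phi>) t \<omega>))
      = (if \<omega> = x then s + r else s - r) *\<^sub>R w" for \<omega>
  proof -
    have "(\<lambda>t. U t (C t (s *\<^sub>R \<phi>) + flip x (\<lambda>t. r *\<^sub>R C t \<phi>) t \<omega>))
       = (\<lambda>t. (if \<omega> = x then s + r else s - r) *\<^sub>R U t (C t \<phi>))"
      by (auto simp: flip_def blinfun.bilinear_simps algebra_simps)
    then show ?thesis unfolding w_def using bochner_scaleR[OF sm fin] by simp
  qed
  then have "mean_square_error T C V U (s *\<^sub>R \<phi>) (fair_pair x y) (flip x (\<lambda>t. r *\<^sub>R C t \<phi>))
    = enn2ereal ((ennreal ((norm (s *\<^sub>R V \<phi> - (s + r) *\<^sub>R w))\<^sup>2)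
        + ennreal ((norm (s *\<^sub>R V \<phi> - (s - r) *\<^sub>R w))\<^sup>2)) / 2)"
    using xy by (simp add: mean_square_error_def nn_integral_fair_pair blinfun.scaleR_right)
  also have "\<dots> = enn2ereal (ennreal (((norm (s *\<^sub>R V \<phi> - (s + r) *\<^sub>R w))\<^sup>2
        + (norm (s *\<^sub>R V \<phi> - (s - r) *\<^sub>R w))\<^sup>2) / 2))"
    by (simp add: ennreal_plus[symmetric] divide_ennreal[symmetric] del: ennreal_plus)
  also have "\<dots> = ereal (s\<^sup>2 * (norm (V \<phi> - w))\<^sup>2 + r\<^sup>2 * (norm w)\<^sup>2)"
    unfolding mean_square_norm_eq by (simp add: enn2ereal_ennreal del: ennreal_plus)
  finally show ?thesis .
qed

theorem theorem4p7:
  fixes j :: "'p::{real_inner,complete_space} \<Rightarrow>\<^sub>L 'h0::{real_inner,complete_space}"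
    and k :: "'h0 \<Rightarrow>\<^sub>L 'm::{real_inner,complete_space}"
    and a :: "'p \<Rightarrow> 'p \<Rightarrow> real"
    and \<gamma> :: "'p \<Rightarrow>\<^sub>L 'b::{real_inner,complete_space}"
    and \<delta> \<delta>p :: "'p \<Rightarrow> ('b \<Rightarrow>\<^sub>L real)"
    and B0 :: "'f0::{real_inner,complete_space} \<Rightarrow>\<^sub>L ('b \<Rightarrow>\<^sub>L real)"
    and B1 :: "'f1::{real_inner,complete_space} \<Rightarrow>\<^sub>L 'h0"
    and V :: "'h0 \<Rightarrow>\<^sub>L 'v::{real_inner,complete_space}"
    and C :: "real \<Rightarrow> ('h0 \<Rightarrow>\<^sub>L 'h::{real_inner,complete_space})"
    and Q :: "real \<Rightarrow> ('h \<Rightarrow>\<^sub>L 'h)"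
    and Q0 :: "'f0 \<Rightarrow>\<^sub>L 'f0"
    and Q1 :: "'f1 \<Rightarrow>\<^sub>L 'f1"
    and T \<gamma>T :: real
    and p z :: "'v \<Rightarrow> 'p"
  assumes neumann: "neumann_problem j k a \<gamma> \<delta> \<delta>p"
    and T_pos: "T > 0"
    and \<gamma>T_pos: "\<gamma>T > 0"
    and C_meas: "\<forall>x. strongly_measurable (lebesgue_on {0..T}) (\<lambda>t. (C t) x)"
    and Q_coercive: "\<exists>\<alpha>::real. \<alpha> \<noteq> 0 \<and> (\<forall>t\<in>{0..T}. self_adjoint_coercive (\<alpha>\<^sup>2) (Q t))"
    and Q_cont: "continuous_on {0..T} (\<lambda>t. norm (Q t))"
    and B_T_ex: "\<forall>x. bochner_integrable (lebesgue_on {0..T}) (observation_density C Q x)"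
    and Q0_coercive: "\<exists>\<beta>0>0. self_adjoint_coercive \<beta>0 Q0"
    and Q1_coercive: "\<exists>\<beta>1>0. self_adjoint_coercive \<beta>1 Q1"
    and nontrivial_sample_type: "\<exists>\<omega> \<omega>' :: 'w. \<omega> \<noteq> \<omega>'"
    and z_eq: "\<forall>l. norm l = 1 \<longrightarrow>
      solves_neumann j (transposed a) \<gamma> \<delta>p
        (inv riesz ((adjoint_op V) (riesz l))
           - (1 / \<gamma>T\<^sup>2) *\<^sub>R B_T T C Q (j (p l)))
        0
        (z l)"
    and p_eq: "\<forall>l. norm l = 1 \<longrightarrow>
      solves_neumann j a \<gamma> \<delta>
        (B1 (inv (blinfun_apply Q1) (inv riesz
           ((adjoint_op B1) (riesz (j (z l)))))))
        (B0 (inv (blinfun_apply Q0) (inv riesz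
           ((adjoint_op B0) (bidual (\<gamma> (z l)))))))
        (p l)"
  shows "(INF U\<in>(L2 T :: (real \<Rightarrow> ('h \<Rightarrow>\<^sub>L 'v)) set).
            SUP (f0, f1, M, \<eta>) \<in> {(f0, f1, M :: 'w measure, \<eta>).
                (f0, f1) \<in> G0 Q0 Q1 \<and> noise T M \<eta> \<and>
                (\<exists>R\<in>G1 TYPE('w) T Q \<gamma>T. correlation_operator T M \<eta> R)}.
              mean_square_error T C V U (j (state j a \<gamma> \<delta> B0 B1 f0 f1)) M \<eta>)
         \<ge> (SUP l\<in>{l. norm l = 1}. ereal (l \<bullet> V (j (p l))))"
proof (intro SUP_least INF_greatest)
  fix l :: 'v and U :: "real \<Rightarrow> ('h \<Rightarrow>\<^sub>L 'v)"
  assume "l \<in> {l. norm l = 1}" and U: "U \<in> L2 T"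
  then have l: "norm l = 1" by simp
  interpret N: neumann_problem j k a \<gamma> \<delta> \<delta>p by (rule neumann)
  interpret Nt: neumann_problem j k "transposed a" \<gamma> \<delta>p \<delta>
    by (rule neumann_problem_transposed[OF neumann])
  let ?\<mu> = "lebesgue_on {0..T}"
  define \<phi> where "\<phi> = j (p l)"
  define f1 where "f1 = inv (blinfun_apply Q1) (inv riesz ((adjoint_op B1) (riesz (j (z l)))))"
  define f0 where "f0 = inv (blinfun_apply Q0) (inv riesz ((adjoint_op B0) (bidual (\<gamma> (z l)))))"
  have Q1f1: "Q1 f1 \<bullet> u = j (z l) \<bullet> B1 u" for u
  proof -
    have "Q1 f1 = inv riesz ((adjoint_op B1) (riesz (j (z l))))"
      using Q1_coercive unfolding f1_def by (blast intro: self_adjoint_coercive_inv)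
    then show ?thesis by (simp add: inner_inv_riesz adjoint_op.rep_eq)
  qed
  have Q0f0: "Q0 f0 \<bullet> u = B0 u (\<gamma> (z l))" for u
  proof -
    have "Q0 f0 = inv riesz ((adjoint_op B0) (bidual (\<gamma> (z l))))"
      using Q0_coercive unfolding f0_def by (blast intro: self_adjoint_coercive_inv)
    then show ?thesis by (simp add: inner_inv_riesz adjoint_op.rep_eq bidual.rep_eq)
  qed
  define A where "A = Q0 f0 \<bullet> f0 + Q1 f1 \<bullet> f1"
  define D where "D = (B_T T C Q \<phi> \<bullet> \<phi>) / \<gamma>T\<^sup>2"
  have sol: "solves_neumann j a \<gamma> \<delta> (B1 f1) (B0 f0) (p l)"
    using p_eq l by (simp add: f0_def f1_def)
  \<comment> \<open>The form is evaluated twice: the equation of \<open>p l\<close> is tested with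
    \<open>z l\<close>, then the transposed equation of \<open>z l\<close> with \<open>p l\<close>.
    In the second the boundary term is zero and \<open>B_T\<close> contributes
    \<open>D\<close>.\<close>
  have "a (p l) (z l) = A"
    using N.solves_neumann_form[OF sol, of "z l"] Q1f1[of f1] Q0f0[of f0]
    by (simp add: A_def inner_commute)
  moreover have "a (p l) (z l) = l \<bullet> V \<phi> - D"
    using Nt.solves_neumann_form[OF z_eq[rule_format, OF l], of "p l"]
    by (simp add: \<phi>_def D_def inner_diff_left inner_inv_riesz adjoint_op.rep_eq)
  ultimately have value_eq: "l \<bullet> V \<phi> = A + D" by simp
  have A: "A \<ge> 0"
  proof -
    have "Q0 f0 \<bullet> f0 \<ge> 0" "Q1 f1 \<bullet> f1 \<ge> 0"
      using Q0_coercive Q1_coercive by (auto intro: self_adjoint_coercive_nonneg)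
    then show ?thesis by (simp add: A_def)
  qed
  define g where "g t = C t \<phi>" for t
  have obs: "observation_density C Q \<phi> t \<bullet> \<phi> = Q t (g t) \<bullet> g t" for t
    by (simp add: inner_observation_density g_def)
  have int: "integrable ?\<mu> (\<lambda>t. Q t (g t) \<bullet> g t)"
    and int_eq: "(\<integral>t. Q t (g t) \<bullet> g t \<partial>?\<mu>) = \<gamma>T\<^sup>2 * D"
    using bochner_inner[OF B_T_ex[rule_format, of \<phi>], of \<phi>] \<gamma>T_pos
    by (simp_all add: obs B_T_def D_def)
  obtain \<alpha> :: real where \<alpha>: "\<alpha> \<noteq> 0" "\<forall>t\<in>{0..T}. self_adjoint_coercive (\<alpha>\<^sup>2) (Q t)"
    using Q_coercive by blast
  \<comment> \<open>Coercivity of \<open>Q t\<close> turns the integrable energy, obtained from the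
    existence of \<open>B_T\<close>, into square integrability of the exact observation.\<close>
  have g_le: "(norm (g t))\<^sup>2 \<le> (Q t (g t) \<bullet> g t) / \<alpha>\<^sup>2" if "t \<in> {0..T}" for t
  proof -
    have "\<alpha>\<^sup>2 * (norm (g t))\<^sup>2 \<le> Q t (g t) \<bullet> g t"
      using \<alpha>(2) that unfolding self_adjoint_coercive_def power2_norm_eq_inner by blast
    then show ?thesis using \<alpha>(1) by (simp add: pos_le_divide_eq mult.commute)
  qed
  have Qg_nonneg: "0 \<le> Q t (g t) \<bullet> g t" if "t \<in> {0..T}" for t
    using order_trans[OF zero_le_power2 g_le[OF that]] \<alpha>(1) by (simp add: zero_le_divide_iff)
  have D: "D \<ge> 0"
  proof -
    have "0 \<le> (\<integral>t. Q t (g t) \<bullet> g t \<partial>?\<mu>)"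
      by (rule Bochner_Integration.integral_nonneg) (use Qg_nonneg in simp)
    then show ?thesis using \<gamma>T_pos by (simp add: int_eq zero_le_mult_iff)
  qed
  have g_meas: "strongly_measurable ?\<mu> g" using C_meas by (simp add: g_def[abs_def])
  have g_fin: "(\<integral>\<^sup>+t. ennreal ((norm (g t))\<^sup>2) \<partial>?\<mu>) < \<infinity>"
  proof -
    have "(\<integral>\<^sup>+t. ennreal ((norm (g t))\<^sup>2) \<partial>?\<mu>) \<le> (\<integral>\<^sup>+t. ennreal ((Q t (g t) \<bullet> g t) / \<alpha>\<^sup>2) \<partial>?\<mu>)"
      by (intro nn_integral_mono ennreal_leI g_le) simp
    also have "\<dots> = ennreal (\<integral>t. (Q t (g t) \<bullet> g t) / \<alpha>\<^sup>2 \<partial>?\<mu>)"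
      by (intro nn_integral_eq_integral integrable_divide int AE_I2) (use Qg_nonneg in simp)
    also have "\<dots> < \<infinity>" by simp
    finally show ?thesis .
  qed
  have U_meas: "strongly_measurable ?\<mu> U" and U_fin: "(\<integral>\<^sup>+t. ennreal ((norm (U t))\<^sup>2) \<partial>?\<mu>) < \<infinity>"
    using U by (auto simp: L2_def)
  have Ug_meas: "strongly_measurable ?\<mu> (\<lambda>t. U t (g t))"
    by (rule strongly_measurable_blinfun_apply[OF _ U_meas g_meas]) simp
  have Ug_fin: "(\<integral>\<^sup>+t. ennreal (norm (U t (g t))) \<partial>?\<mu>) < \<infinity>"
  proof -
    have "(\<integral>\<^sup>+t. ennreal (norm (U t (g t))) \<partial>?\<mu>)
        \<le> (\<integral>\<^sup>+t. ennreal ((norm (U t))\<^sup>2) + ennreal ((norm (g t))\<^sup>2) \<partial>?\<mu>)"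
    proof (rule nn_integral_mono)
      fix t
      have "norm (U t (g t)) \<le> norm (U t) * norm (g t)" by (rule norm_blinfun)
      also have "\<dots> \<le> (norm (U t))\<^sup>2 + (norm (g t))\<^sup>2"
      proof -
        have "2 * (norm (U t) * norm (g t)) \<le> (norm (U t))\<^sup>2 + (norm (g t))\<^sup>2"
          using sum_squares_bound[of "norm (U t)" "norm (g t)"] by (simp only: mult.assoc)
        moreover have "0 \<le> norm (U t) * norm (g t)" by simp
        ultimately show ?thesis by linarith
      qed
      finally show "ennreal (norm (U t (g t))) \<le> ennreal ((norm (U t))\<^sup>2) + ennreal ((norm (g t))\<^sup>2)"
        by (metis ennreal_leI ennreal_plus zero_le_power2)
    qed
    also have "\<dots> = (\<integral>\<^sup>+t. ennreal ((norm (U t))\<^sup>2) \<partial>?\<mu>) + (\<integral>\<^sup>+t. ennreal ((norm (g t))\<^sup>2) \<partial>?\<mu>)"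
      by (intro nn_integral_add measurable_compose[OF strongly_measurable_norm] U_meas g_meas) measurable
    also have "\<dots> < \<infinity>" using U_fin g_fin by simp
    finally show ?thesis .
  qed
  define w where "w = bochner ?\<mu> (\<lambda>t. U t (C t \<phi>))"
  obtain s where s: "s\<^sup>2 * A \<le> 1" "2 * norm (V \<phi> - w) - A \<le> s\<^sup>2 * (norm (V \<phi> - w))\<^sup>2"
    using exists_scaling_square_ge[OF A, of "norm (V \<phi> - w)"] by auto
  obtain r where r: "r\<^sup>2 * D \<le> 1" "2 * norm w - D \<le> r\<^sup>2 * (norm w)\<^sup>2"
    using exists_scaling_square_ge[OF D, of "norm w"] by auto
  obtain x y :: 'w where xy: "x \<noteq> y" using nontrivial_sample_type by blast
  \<comment> \<open>This is the deterministic profile; the noise process is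
    \<open>flip x \<eta>\<close>.\<close>
  define \<eta> where "\<eta> = (\<lambda>t. r *\<^sub>R C t \<phi>)"
  have \<eta>_meas: "strongly_measurable ?\<mu> \<eta>"
    using strongly_measurable_scaleR[OF g_meas] by (simp add: \<eta>_def g_def)
  have \<eta>_fin: "(\<integral>\<^sup>+t. ennreal ((norm (\<eta> t))\<^sup>2) \<partial>?\<mu>) < \<infinity>"
  proof -
    note strongly_measurable_norm[OF g_meas, measurable]
    have "(\<integral>\<^sup>+t. ennreal ((norm (\<eta> t))\<^sup>2) \<partial>?\<mu>) = (\<integral>\<^sup>+t. ennreal (r\<^sup>2) * ennreal ((norm (g t))\<^sup>2) \<partial>?\<mu>)"
      by (simp add: \<eta>_def g_def power_mult_distrib ennreal_mult)
    also have "\<dots> = ennreal (r\<^sup>2) * (\<integral>\<^sup>+t. ennreal ((norm (g t))\<^sup>2) \<partial>?\<mu>)"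
      by (rule nn_integral_cmult) measurable
    also have "\<dots> < \<infinity>" using g_fin by (simp add: ennreal_mult_less_top)
    finally show ?thesis .
  qed
  \<comment> \<open>The factor \<open>1 / \<gamma>T\<^sup>2\<close> in \<open>D\<close> is what
    turns the noise budget into \<open>r\<^sup>2 * D \<le> 1\<close>.\<close>
  have "(\<integral>\<^sup>+t. ennreal (Q t (\<eta> t) \<bullet> \<eta> t) \<partial>?\<mu>) = (\<integral>\<^sup>+t. ennreal (r\<^sup>2 * (Q t (g t) \<bullet> g t)) \<partial>?\<mu>)"
    by (simp add: \<eta>_def g_def blinfun.scaleR_right power2_eq_square mult.assoc)
  also have "\<dots> = ennreal (\<integral>t. r\<^sup>2 * (Q t (g t) \<bullet> g t) \<partial>?\<mu>)"
    by (intro nn_integral_eq_integral integrable_mult_right int AE_I2) (use Qg_nonneg in simp)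
  also have "\<dots> = ennreal (\<gamma>T\<^sup>2 * (r\<^sup>2 * D))"
    by (simp add: int_eq mult.left_commute)
  also have "\<dots> \<le> ennreal (\<gamma>T\<^sup>2)"
    using mult_left_mono[OF r(1), of "\<gamma>T\<^sup>2"] by (intro ennreal_leI) simp
  finally have \<eta>_Q: "(\<integral>\<^sup>+t. ennreal (Q t (\<eta> t) \<bullet> \<eta> t) \<partial>?\<mu>) \<le> ennreal (\<gamma>T\<^sup>2)" .
  have "Q0 (s *\<^sub>R f0) \<bullet> (s *\<^sub>R f0) + Q1 (s *\<^sub>R f1) \<bullet> (s *\<^sub>R f1) = s\<^sup>2 * A"
    by (simp add: A_def blinfun.scaleR_right power2_eq_square algebra_simps)
  then have f_in: "(s *\<^sub>R f0, s *\<^sub>R f1) \<in> G0 Q0 Q1" using s(1) by (simp add: G0_def)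
  have state: "j (state j a \<gamma> \<delta> B0 B1 (s *\<^sub>R f0) (s *\<^sub>R f1)) = s *\<^sub>R \<phi>"
    using N.state_eq[of B1 "s *\<^sub>R f1" B0 "s *\<^sub>R f0" "s *\<^sub>R p l"] N.solves_neumann_scaleR[OF sol, of s]
    by (simp add: blinfun.scaleR_right \<phi>_def)
  \<comment> \<open>Since \<open>l\<close> is a unit vector, \<open>A + D\<close> is at most
    \<open>norm (V \<phi> - w) + norm w\<close>, which is the condition under which the two scaling
    bounds add up to at least \<open>A + D\<close>.\<close>
  have "l \<bullet> V \<phi> \<le> norm (V \<phi>)"
    using norm_cauchy_schwarz[of l "V \<phi>"] l by simp
  also have "\<dots> \<le> norm (V \<phi> - w) + norm w"
    using norm_triangle_ineq[of "V \<phi> - w" w] by simp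
  finally have "l \<bullet> V \<phi> \<le> s\<^sup>2 * (norm (V \<phi> - w))\<^sup>2 + r\<^sup>2 * (norm w)\<^sup>2"
    using value_eq s(2) r(2) by linarith
  then have "ereal (l \<bullet> V (j (p l))) \<le>
      mean_square_error T C V U (j (state j a \<gamma> \<delta> B0 B1 (s *\<^sub>R f0) (s *\<^sub>R f1))) (fair_pair x y) (flip x \<eta>)"
    using mean_square_error_flip[OF xy, of T U C \<phi> V s r] Ug_meas Ug_fin
    unfolding state \<eta>_def w_def g_def \<phi>_def by simp
  also have "\<dots> \<le> (SUP (f0, f1, M, \<eta>) \<in> {(f0, f1, M :: 'w measure, \<eta>).
                (f0, f1) \<in> G0 Q0 Q1 \<and> noise T M \<eta> \<and>
                (\<exists>R\<in>G1 TYPE('w) T Q \<gamma>T. correlation_operator T M \<eta> R)}.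
              mean_square_error T C V U (j (state j a \<gamma> \<delta> B0 B1 f0 f1)) M \<eta>)"
    using f_in flip_noise[OF xy \<eta>_meas \<eta>_fin] flip_in_G1[OF xy \<eta>_meas \<eta>_fin \<eta>_Q]
    by (intro SUP_upper2[of "(s *\<^sub>R f0, s *\<^sub>R f1, fair_pair x y, flip x \<eta>)"]) auto
  finally show "ereal (l \<bullet> V (j (p l))) \<le> (SUP (f0, f1, M, \<eta>) \<in> {(f0, f1, M :: 'w measure, \<eta>).
                (f0, f1) \<in> G0 Q0 Q1 \<and> noise T M \<eta> \<and>
                (\<exists>R\<in>G1 TYPE('w) T Q \<gamma>T. correlation_operator T M \<eta> R)}.
              mean_square_error T C V U (j (state j a \<gamma> \<delta> B0 B1 f0 f1)) M \<eta>)" .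
qed

end
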